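(* Let $A,B$ be the matrices defined in the context (uniform grid, Dirichlet boundary conditions), let $$\widehat C=(|w_{-1}|-10w_2)(\alpha+\beta)-(r+\lambda)+\lambda\sqrt{L_y\|f\|_\infty},\qquad \widehat C^+=\max(\widehat C,0),$$ and let $R(z)=\dfrac{1+\frac12z}{1-\frac12z}$ be the stability function of the Crank--Nicolson scheme. Let $T>0$. Then the Crank--Nicolson scheme is stable in the $\ell_2$-norm in the sense that $$\|R(\Delta t(A+B))\|_2^n\le e^{2T\widehat C^+}\quad\text{whenever } n=0,1,2,\dots \text{ with } n\Delta t\le T \text{ and } \widehat C\Delta t\le1.$$
   Context: Parameters: $\alpha,\beta,\sigma,\lambda,\Delta t>0$, $\mu,r\in\mathbb R$; $f$ is a bounded probability density on $\mathbb R$, $\|f\|_\infty=\sup_{\xi}|f(\xi)|<\infty$, $L_y=y_{\max}-y_{\min}$. The real weights satisfy $\sum_{k=-1}^2w_k=0$, $\sum_{k=-1}^2kw_k=1$, $\sum_{k=-1}^2k^2w_k=0$, $w_2\le0$. Grid: $x_{\min}=x_{-1}<x_0<\dots<x_{m_1}<x_{m_1+1}=x_{\max}$ and $y_{\min}=y_{-1}<y_0<\dots<y_{m_2}<y_{m_2+1}=y_{\max}$ are uniform meshes with widths $\Delta x,\Delta y$. The unknowns are $V=(V_{i,j})_{0\le i\le m_1,0\le j\le m_2}$ (entry $i(m_2+1)+j$); values at indices $-1$, $m_1+1$ (in $i$) and $-1$, $m_2+1$ (in $j$) are boundary values. Put $a_i=\alpha(\mu-x_i)$, $b_j=-\beta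 y_j$, $c^+=\max(c,0)$, $c^-=\min(c,0)$. Standing assumption: $a(x)=\alpha(\mu-x)$ and $b(y)=-\beta y$ change sign within the domain, being positive near $x_{\min},y_{\min}$ and negative near $x_{\max},y_{\max}$: $a_0>0>a_{m_1}$, $b_0>0>b_{m_2}$ (so no stencil below extends beyond the boundary nodes). The matrices $A,B$ are obtained from the following formulas by setting all boundary values equal to zero: $(AV)_{i,j}=\frac{\sigma^2}{2}\frac{V_{i-1,j}-2V_{i,j}+V_{i+1,j}}{\Delta x^2}-(r+\lambda)V_{i,j}+a_i^+\frac{w_2V_{i+2,j}+w_1V_{i+1,j}+w_0V_{i,j}+w_{-1}V_{i-1,j}}{\Delta x}+a_i^-\frac{-w_{-1}V_{i+1,j}-w_0V_{i,j}-w_1V_{i-1,j}-w_2V_{i-2,j}}{\Delta x}+b_j^+\frac{w_2V_{i,j+2}+w_1V_{i,j+1}+w_0V_{i,j}+w_{-1}V_{i,j-1}}{\Delta y}+b_j^-\frac{-w_{-1}V_{i,j+1}-w_0V_{i,j}-w_1V_{i,j-1}-w_2V_{i,j-2}}{\Delta y},$ $(BV)_{i,j}=\lambda\sum_{\ell=-1}^{m_2}\int_{y_\ell}^{y_{\ell+1}}\Big(\frac{y_{\ell+1}-\xi}{\Delta y}V_{i,\ell}+\frac{\xi-y_\ell}{\Delta y}V_{i,\ell+1}\Big)f(\xi-y_j)\,d\xi.$ For a square matrix $M$, $R(M)=(I-\frac12M)^{-1}(I+\frac12M)$. The vector norm is $\|V\|_2=\sqrt{\langle V,V\rangle}$ with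 $\langle U,V\rangle=\Delta x\Delta y\sum_kU_kV_k$, and $\|M\|_2$ is the induced (spectral) matrix norm. *)

theory Defs
  imports
    "HOL-Analysis.Analysis"
    "Jordan_Normal_Form.Gauss_Jordan_Elimination"
begin

unbundle no vec_syntax
hide_type (open) Finite_Cartesian_Product.vec
hide_const (open) Finite_Cartesian_Product.vec

definition prob_density :: "(real \<Rightarrow> real) \<Rightarrow> bool" where
  "prob_density f \<longleftrightarrow>
     (\<forall>\<xi>. 0 \<le> f \<xi>) \<and> integrable lebesgue f \<and> (LINT \<xi>|lebesgue. f \<xi>) = 1"

definition sup_norm :: "(real \<Rightarrow> real) \<Rightarrow> real" where
  "sup_norm f = (SUP \<xi>. \<bar>f \<xi>\<bar>)"

text \<open>
  A uniform mesh of width \<open>h\<close> with nodes \<open>x (-1), \<dots>, x (m + 1)\<close>; the values of \<open>x\<close> at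
  other indices play no role.
\<close>
definition uniform_grid :: "real \<Rightarrow> real \<Rightarrow> nat \<Rightarrow> real \<Rightarrow> (int \<Rightarrow> real) \<Rightarrow> bool" where
  "uniform_grid lo hi m h x \<longleftrightarrow>
     0 < h \<and> x (- 1) = lo \<and> x (int m + 1) = hi \<and>
     (\<forall>i \<in> {- 1 .. int m}. x (i + 1) - x i = h)"

definition num_unknowns :: "nat \<Rightarrow> nat \<Rightarrow> nat" where
  "num_unknowns m1 m2 = (m1 + 1) * (m2 + 1)"

text \<open>
  The grid function belonging to a vector of unknowns, with all boundary values equal to zero.
  It is also zero beyond the boundary nodes; when the drift coefficients change sign inside the
  domain, such values only ever occur with coefficient zero.
\<close>
definition dirichlet_ext :: "nat \<Rightarrow> nat \<Rightarrow> real vec \<Rightarrow> int \<Rightarrow> int \<Rightarrow> real" where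
  "dirichlet_ext m1 m2 V i j =
     (if 0 \<le> i \<and> i \<le> int m1 \<and> 0 \<le> j \<and> j \<le> int m2
      then V $ (nat i * (m2 + 1) + nat j) else 0)"

definition diff_op ::
    "real \<Rightarrow> real \<Rightarrow> real \<Rightarrow> real \<Rightarrow> real \<Rightarrow> real \<Rightarrow> (int \<Rightarrow> real) \<Rightarrow> (int \<Rightarrow> real) \<Rightarrow> (int \<Rightarrow> real)
      \<Rightarrow> real \<Rightarrow> real \<Rightarrow> (int \<Rightarrow> int \<Rightarrow> real) \<Rightarrow> int \<Rightarrow> int \<Rightarrow> real" where
  "diff_op \<alpha> \<mu> \<beta> \<sigma> r lam w x y dx dy W i j =
     (let a = \<alpha> * (\<mu> - x i); b = - \<beta> * y j in
      \<sigma>\<^sup>2 / 2 * ((W (i - 1) j - 2 * W i j + W (i + 1) j) / dx\<^sup>2)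
      - (r + lam) * W i j
      + max a 0 * ((w 2 * W (i + 2) j + w 1 * W (i + 1) j + w 0 * W i j
                    + w (- 1) * W (i - 1) j) / dx)
      + min a 0 * ((- w (- 1) * W (i + 1) j - w 0 * W i j - w 1 * W (i - 1) j
                    - w 2 * W (i - 2) j) / dx)
      + max b 0 * ((w 2 * W i (j + 2) + w 1 * W i (j + 1) + w 0 * W i j
                    + w (- 1) * W i (j - 1)) / dy)
      + min b 0 * ((- w (- 1) * W i (j + 1) - w 0 * W i j - w 1 * W i (j - 1)
                    - w 2 * W i (j - 2)) / dy))"

definition jump_op ::
    "real \<Rightarrow> (real \<Rightarrow> real) \<Rightarrow> (int \<Rightarrow> real) \<Rightarrow> real \<Rightarrow> nat
      \<Rightarrow> (int \<Rightarrow> int \<Rightarrow> real) \<Rightarrow> int \<Rightarrow> int \<Rightarrow> real" where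
  "jump_op lam f y dy m2 W i j =
     lam * (\<Sum>l = - 1 .. int m2.
       (LINT \<xi>:{y l .. y (l + 1)}|lebesgue.
          ((y (l + 1) - \<xi>) / dy * W i l + (\<xi> - y l) / dy * W i (l + 1)) * f (\<xi> - y j)))"

text \<open>
  The matrix of a linear operator on grid functions under zero boundary values: its columns are
  the images of the unit vectors, and row \<open>k\<close> belongs to the node
  \<open>(k div (m2 + 1), k mod (m2 + 1))\<close>.
\<close>
definition grid_matrix ::
    "nat \<Rightarrow> nat \<Rightarrow> ((int \<Rightarrow> int \<Rightarrow> real) \<Rightarrow> int \<Rightarrow> int \<Rightarrow> real) \<Rightarrow> real mat" where
  "grid_matrix m1 m2 F =
     (let N = num_unknowns m1 m2 in
      mat N N (\<lambda>(k, l). F (dirichlet_ext m1 m2 (unit_vec N l))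
                         (int (k div (m2 + 1))) (int (k mod (m2 + 1)))))"

definition matA ::
    "real \<Rightarrow> real \<Rightarrow> real \<Rightarrow> real \<Rightarrow> real \<Rightarrow> real \<Rightarrow> (int \<Rightarrow> real) \<Rightarrow> (int \<Rightarrow> real) \<Rightarrow> (int \<Rightarrow> real)
      \<Rightarrow> real \<Rightarrow> real \<Rightarrow> nat \<Rightarrow> nat \<Rightarrow> real mat" where
  "matA \<alpha> \<mu> \<beta> \<sigma> r lam w x y dx dy m1 m2 =
     grid_matrix m1 m2 (diff_op \<alpha> \<mu> \<beta> \<sigma> r lam w x y dx dy)"

definition matB ::
    "real \<Rightarrow> (real \<Rightarrow> real) \<Rightarrow> (int \<Rightarrow> real) \<Rightarrow> real \<Rightarrow> nat \<Rightarrow> nat \<Rightarrow> real mat" where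
  "matB lam f y dy m1 m2 = grid_matrix m1 m2 (jump_op lam f y dy m2)"

definition cn_denominator :: "real mat \<Rightarrow> real mat" where
  "cn_denominator M = 1\<^sub>m (dim_row M) - (1 / 2) \<cdot>\<^sub>m M"

text \<open>Only meaningful if \<open>cn_denominator M\<close> is invertible, as \<open>mat_inverse\<close> is \<open>None\<close> otherwise.\<close>
definition cn_stability :: "real mat \<Rightarrow> real mat" where
  "cn_stability M =
     the (mat_inverse (cn_denominator M)) * (1\<^sub>m (dim_row M) + (1 / 2) \<cdot>\<^sub>m M)"

definition grid_inner :: "real \<Rightarrow> real \<Rightarrow> real vec \<Rightarrow> real vec \<Rightarrow> real" where
  "grid_inner dx dy U V = dx * dy * (\<Sum>k < dim_vec V. U $ k * V $ k)"

definition grid_norm :: "real \<Rightarrow> real \<Rightarrow> real vec \<Rightarrow> real" where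
  "grid_norm dx dy V = sqrt (grid_inner dx dy V V)"

definition spectral_norm :: "real \<Rightarrow> real \<Rightarrow> real mat \<Rightarrow> real" where
  "spectral_norm dx dy M =
     (SUP V \<in> carrier_vec (dim_col M) - {0\<^sub>v (dim_col M)}.
        grid_norm dx dy (M *\<^sub>v V) / grid_norm dx dy V)"

definition C_hat ::
    "real \<Rightarrow> real \<Rightarrow> real \<Rightarrow> real \<Rightarrow> (int \<Rightarrow> real) \<Rightarrow> real \<Rightarrow> (real \<Rightarrow> real) \<Rightarrow> real" where
  "C_hat \<alpha> \<beta> r lam w Ly f =
     (\<bar>w (- 1)\<bar> - 10 * w 2) * (\<alpha> + \<beta>) - (r + lam) + lam * sqrt (Ly * sup_norm f)"

text \<open>
  The matrices act on arbitrary vectors of unknowns by the difference and quadrature formulas.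
\<close>

lemma dirichlet_ext_expand:
  assumes "V \<in> carrier_vec (num_unknowns m1 m2)"
  shows "dirichlet_ext m1 m2 V i j =
    (\<Sum>l < num_unknowns m1 m2.
      V $ l * dirichlet_ext m1 m2 (unit_vec (num_unknowns m1 m2) l) i j)"
proof (cases "0 \<le> i \<and> i \<le> int m1 \<and> 0 \<le> j \<and> j \<le> int m2")
  case True
  define N where "N = num_unknowns m1 m2"
  define k where "k = nat i * (m2 + 1) + nat j"
  have "nat i * (m2 + 1) \<le> m1 * (m2 + 1)" "nat j < m2 + 1"
    using True by (auto intro: mult_right_mono simp del: mult_Suc_right)
  then have k: "k < N"
    unfolding k_def N_def num_unknowns_def by (simp add: algebra_simps)
  have "(\<Sum>l<N. V $ l * unit_vec N l $ k) = (\<Sum>l<N. if l = k then V $ l else 0)"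
    using k by (intro sum.cong) (auto simp: unit_vec_def)
  also have "\<dots> = V $ k"
    using k by (simp add: sum.delta)
  finally have "(\<Sum>l<N. V $ l * unit_vec N l $ k) = V $ k" .
  moreover have "dirichlet_ext m1 m2 U i j = U $ k" for U
    using True by (simp add: dirichlet_ext_def k_def)
  ultimately show ?thesis
    unfolding N_def by simp
next
  case False
  then have "\<And>U. dirichlet_ext m1 m2 U i j = 0"
    by (auto simp: dirichlet_ext_def)
  then show ?thesis by simp
qed

lemma grid_matrix_mult_vec:
  assumes V: "V \<in> carrier_vec (num_unknowns m1 m2)" and "i \<le> m1" "j \<le> m2"
    and F: "\<And>c U. F (\<lambda>i j. \<Sum>l < num_unknowns m1 m2. c l * U l i j) (int i) (int j)
              = (\<Sum>l < num_unknowns m1 m2. c l * F (U l) (int i) (int j))"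
  shows "(grid_matrix m1 m2 F *\<^sub>v V) $ (i * (m2 + 1) + j)
    = F (dirichlet_ext m1 m2 V) (int i) (int j)"
proof -
  define N where "N = num_unknowns m1 m2"
  define k where "k = i * (m2 + 1) + j"
  have "i * (m2 + 1) \<le> m1 * (m2 + 1)"
    using assms by (intro mult_right_mono) auto
  then have k: "k < N"
    unfolding k_def N_def num_unknowns_def using \<open>j \<le> m2\<close> by (simp add: algebra_simps)
  have "k div (m2 + 1) = (j + i * (m2 + 1)) div (m2 + 1)"
    "k mod (m2 + 1) = (j + i * (m2 + 1)) mod (m2 + 1)"
    by (simp_all only: k_def add.commute)
  then have km: "k div (m2 + 1) = i" "k mod (m2 + 1) = j"
    using \<open>j \<le> m2\<close> by (simp_all only: div_mult_self1 mod_mult_self1) auto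
  have "(grid_matrix m1 m2 F *\<^sub>v V) $ k
      = (\<Sum>l<N. V $ l * F (dirichlet_ext m1 m2 (unit_vec N l)) (int i) (int j))"
    using k V km unfolding N_def[symmetric] grid_matrix_def Let_def
    by (auto simp: scalar_prod_def atLeast0LessThan N_def[symmetric] intro!: sum.cong)
  also have "\<dots> = F (\<lambda>i j. \<Sum>l<N. V $ l * dirichlet_ext m1 m2 (unit_vec N l) i j) (int i) (int j)"
    using F[of "\<lambda>l. V $ l"] by (simp add: N_def)
  also have "(\<lambda>i j. \<Sum>l<N. V $ l * dirichlet_ext m1 m2 (unit_vec N l) i j) = dirichlet_ext m1 m2 V"
    using dirichlet_ext_expand[OF V] by (auto simp: N_def fun_eq_iff)
  finally show ?thesis by (simp add: k_def)
qed

lemma matA_mult_vec: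
  assumes "V \<in> carrier_vec (num_unknowns m1 m2)" "i \<le> m1" "j \<le> m2"
  shows "(matA \<alpha> \<mu> \<beta> \<sigma> r lam w x y dx dy m1 m2 *\<^sub>v V) $ (i * (m2 + 1) + j)
    = diff_op \<alpha> \<mu> \<beta> \<sigma> r lam w x y dx dy (dirichlet_ext m1 m2 V) (int i) (int j)"
  unfolding matA_def
proof (rule grid_matrix_mult_vec[OF assms])
  fix c :: "nat \<Rightarrow> real" and U :: "nat \<Rightarrow> int \<Rightarrow> int \<Rightarrow> real"
  have "diff_op \<alpha> \<mu> \<beta> \<sigma> r lam w x y dx dy (\<lambda>i j. \<Sum>l<n. c l * U l i j) (int i) (int j)
      = (\<Sum>l<n. c l * diff_op \<alpha> \<mu> \<beta> \<sigma> r lam w x y dx dy (U l) (int i) (int j))" for n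
  proof (induction n)
    case 0
    then show ?case by (simp add: diff_op_def Let_def)
  next
    case (Suc n)
    have "diff_op \<alpha> \<mu> \<beta> \<sigma> r lam w x y dx dy (\<lambda>i j. W i j + d * W' i j) i' j'
      = diff_op \<alpha> \<mu> \<beta> \<sigma> r lam w x y dx dy W i' j' + d * diff_op \<alpha> \<mu> \<beta> \<sigma> r lam w x y dx dy W' i' j'"
      for W W' d i' j'
      by (simp add: diff_op_def Let_def add_divide_distrib diff_divide_distrib algebra_simps)
    then show ?case using Suc by simp
  qed
  then show "diff_op \<alpha> \<mu> \<beta> \<sigma> r lam w x y dx dy
        (\<lambda>i j. \<Sum>l < num_unknowns m1 m2. c l * U l i j) (int i) (int j)
      = (\<Sum>l < num_unknowns m1 m2. c l * diff_op \<alpha> \<mu> \<beta> \<sigma> r lam w x y dx dy (U l) (int i) (int j))" .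
qed

lemma jump_integrand_integrable:
  fixes f :: "real \<Rightarrow> real"
  assumes "integrable lebesgue f"
  shows "set_integrable lebesgue {s..t} (\<lambda>\<xi>. ((t - \<xi>) / h * p + (\<xi> - s) / h * q) * f (\<xi> - c))"
proof -
  have "integrable lebesgue (\<lambda>\<xi>. f (\<xi> - c))"
    using lebesgue_integrable_real_affine[OF assms, of 1 "- c"] by simp
  then have "(\<lambda>\<xi>. f (\<xi> - c)) absolutely_integrable_on UNIV"
    by (simp add: set_integrable_def)
  then have *: "(\<lambda>\<xi>. f (\<xi> - c)) absolutely_integrable_on {s..t}"
    by (rule set_integrable_subset) auto
  have cont: "continuous_on {s..t} (\<lambda>\<xi>. (t - \<xi>) / h * p + (\<xi> - s) / h * q)"
    by (cases "h = 0") (auto intro!: continuous_intros)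
  have bdd: "bounded ((\<lambda>\<xi>. (t - \<xi>) / h * p + (\<xi> - s) / h * q) ` {s..t})"
    by (intro compact_imp_bounded compact_continuous_image[OF cont]) simp
  have "(\<lambda>\<xi>. ((t - \<xi>) / h * p + (\<xi> - s) / h * q) * f (\<xi> - c)) absolutely_integrable_on {s..t}"
    by (rule absolutely_integrable_bounded_measurable_product_real
        [OF continuous_imp_measurable_on_sets_lebesgue[OF cont] _ bdd *]) simp_all
  then show ?thesis .
qed

lemma matB_mult_vec:
  assumes "integrable lebesgue f"
    and "V \<in> carrier_vec (num_unknowns m1 m2)" "i \<le> m1" "j \<le> m2"
  shows "(matB lam f y dy m1 m2 *\<^sub>v V) $ (i * (m2 + 1) + j)
    = jump_op lam f y dy m2 (dirichlet_ext m1 m2 V) (int i) (int j)"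
  unfolding matB_def
proof (rule grid_matrix_mult_vec[OF assms(2-4)])
  fix c :: "nat \<Rightarrow> real" and U :: "nat \<Rightarrow> int \<Rightarrow> int \<Rightarrow> real"
  have "jump_op lam f y dy m2 (\<lambda>i j. \<Sum>l<n. c l * U l i j) (int i) (int j)
      = (\<Sum>l<n. c l * jump_op lam f y dy m2 (U l) (int i) (int j))" for n
  proof (induction n)
    case 0
    then show ?case by (simp add: jump_op_def set_lebesgue_integral_def)
  next
    case (Suc n)
    have "jump_op lam f y dy m2 (\<lambda>i j. W i j + d * W' i j) i' j'
      = jump_op lam f y dy m2 W i' j' + d * jump_op lam f y dy m2 W' i' j'"
      for W W' d i' j'
    proof -
      define g where "g W l \<xi> = ((y (l + 1) - \<xi>) / dy * W i' l + (\<xi> - y l) / dy * W i' (l + 1))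
        * f (\<xi> - y j')" for W :: "int \<Rightarrow> int \<Rightarrow> real" and l \<xi>
      have int: "set_integrable lebesgue {y l..y (l + 1)} (g W l)" for W l
        unfolding g_def by (rule jump_integrand_integrable[OF assms(1)])
      have "g (\<lambda>i j. W i j + d * W' i j) l \<xi> = g W l \<xi> + d * g W' l \<xi>" for l \<xi>
        by (simp add: g_def algebra_simps add_divide_distrib diff_divide_distrib)
      then have "(LINT \<xi>:{y l..y (l + 1)}|lebesgue. g (\<lambda>i j. W i j + d * W' i j) l \<xi>)
        = (LINT \<xi>:{y l..y (l + 1)}|lebesgue. g W l \<xi>)
          + d * (LINT \<xi>:{y l..y (l + 1)}|lebesgue. g W' l \<xi>)" for l
        using int by (simp add: set_integral_add)
      moreover have "jump_op lam f y dy m2 Z i' j'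
        = lam * (\<Sum>l = - 1..int m2. (LINT \<xi>:{y l..y (l + 1)}|lebesgue. g Z l \<xi>))" for Z
        by (simp add: jump_op_def g_def)
      ultimately show ?thesis
        by (simp only: sum.distrib distrib_left sum_distrib_left mult.left_commute[of d])
    qed
    then show ?case using Suc by simp
  qed
  then show "jump_op lam f y dy m2
        (\<lambda>i j. \<Sum>l < num_unknowns m1 m2. c l * U l i j) (int i) (int j)
      = (\<Sum>l < num_unknowns m1 m2. c l * jump_op lam f y dy m2 (U l) (int i) (int j))" .
qed

end

(*
  Both the difference matrix A and the jump matrix B are bounded from above as quadratic forms.
  Diffusion is nonpositive. With q = -w_2 the weights are w_{-1} = q - 1/2, w_0 = -3q,
  w_1 = 3q + 1/2, so an upwind stencil is the central difference plus q times a third difference.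
  Since the drift a is affine with slope -alpha, summation by parts bounds the central part
  by alpha/2. For a constant coefficient the symbol of the third difference is
  -2(1 - cos theta)^2 <= 0, and the variation of the coefficient costs at most 5/2 q alpha for each
  of the two drift signs; 1/2 + 5q <= |w_{-1}| + 10q. A Schur test gives
  lambda sqrt(L_y ||f||) for B. Hence <V, M V> <= 2h <V, V> with 0 <= h <= 1/2 for
  M = dt (A + B), and an exact identity for the Cayley transform gives
  ||R(M)|| <= (1 + h)/(1 - h) <= exp (4h).
*)
theory Submission
  imports Defs "Jordan_Normal_Form.Determinant"
begin

subsection \<open>Quadratic forms of the difference stencils\<close>

lemma sum_telescope_int:
  fixes G :: "int \<Rightarrow> 'a::ab_group_add"
  shows "(\<Sum>i = 0..int m. G (i + 1) - G i) = G (int m + 1) - G 0"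
proof (induction m)
  case (Suc m)
  have "{0..int (Suc m)} = insert (int m + 1) {0..int m}" by auto
  with Suc show ?case by (simp add: add.commute)
qed simp

lemma sum_int_interval_eq_nat:
  fixes g :: "int \<Rightarrow> 'a::comm_monoid_add"
  shows "(\<Sum>i = 0..int m. g i) = (\<Sum>i<Suc m. g (int i))"
proof (induction m)
  case (Suc m)
  have "{0..int (Suc m)} = insert (int m + 1) {0..int m}" by auto
  with Suc show ?case by (simp add: add.commute)
qed simp

text \<open>Three moment conditions on four weights leave one free parameter, taken to be
  \<open>w 2\<close>. At \<open>w 2 = 0\<close> the stencil is the central difference; otherwise a
  multiple of a third difference is added to it.\<close>

lemma weights_solve:
  fixes w :: "int \<Rightarrow> real"
  assumes "(\<Sum>k = - 1..2. w k) = 0"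
    and "(\<Sum>k = - 1..2. of_int k * w k) = 1"
    and "(\<Sum>k = - 1..2. (of_int k)\<^sup>2 * w k) = 0"
  shows "w (- 1) = - 1 / 2 - w 2" "w 0 = 3 * w 2" "w 1 = 1 / 2 - 3 * w 2"
proof -
  have "{- 1..2::int} = {- 1, 0, 1, 2}" by auto
  then show "w (- 1) = - 1 / 2 - w 2" "w 0 = 3 * w 2" "w 1 = 1 / 2 - 3 * w 2"
    using assms by simp_all
qed

section \<open>Energy estimates for sequences extended by zero\<close>

context
  fixes m :: nat and W :: "int \<Rightarrow> real"
  assumes zero: "\<And>i. i < 0 \<or> i > int m \<Longrightarrow> W i = 0"
begin

text \<open>Shifting the window by one cell drops the square at one end, and only a zero enters at
  the other. This bound and its mirror image below absorb all shifted squares.\<close>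

lemma sum_square_pred_le: "(\<Sum>i = 0..int m. (W (i - 1))\<^sup>2) \<le> (\<Sum>i = 0..int m. (W i)\<^sup>2)"
proof -
  have "(\<Sum>i = 0..int m. (W i)\<^sup>2) - (\<Sum>i = 0..int m. (W (i - 1))\<^sup>2) = (W (int m))\<^sup>2"
    using sum_telescope_int[of "\<lambda>i. (W (i - 1))\<^sup>2" m] zero[of "- 1"] by (simp add: sum_subtractf)
  moreover have "(W (int m))\<^sup>2 \<ge> 0" by simp
  ultimately show ?thesis by linarith
qed

lemma sum_square_succ_le: "(\<Sum>i = 0..int m. (W (i + 1))\<^sup>2) \<le> (\<Sum>i = 0..int m. (W i)\<^sup>2)"
proof -
  have "(\<Sum>i = 0..int m. (W (i + 1))\<^sup>2) - (\<Sum>i = 0..int m. (W i)\<^sup>2) = - (W 0)\<^sup>2"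
    using sum_telescope_int[of "\<lambda>i. (W i)\<^sup>2" m] zero[of "int m + 1"] by (simp add: sum_subtractf)
  moreover have "(W 0)\<^sup>2 \<ge> 0" by simp
  ultimately show ?thesis by linarith
qed

text \<open>Young's inequality turns both cross products into squares whose coefficients add up to
  zero; the shift bounds do the rest.\<close>

lemma diffusion_form_nonpos: "(\<Sum>i = 0..int m. W i * (W (i - 1) - 2 * W i + W (i + 1))) \<le> 0"
proof -
  have "(\<Sum>i = 0..int m. W i * (W (i - 1) - 2 * W i + W (i + 1)))
      \<le> (\<Sum>i = 0..int m. (W (i - 1))\<^sup>2 / 2 - (W i)\<^sup>2 + (W (i + 1))\<^sup>2 / 2)"
  proof (rule sum_mono)
    fix i :: int
    have "(W i - W (i - 1))\<^sup>2 \<ge> 0" "(W i - W (i + 1))\<^sup>2 \<ge> 0" by simp_all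
    then show "W i * (W (i - 1) - 2 * W i + W (i + 1))
        \<le> (W (i - 1))\<^sup>2 / 2 - (W i)\<^sup>2 + (W (i + 1))\<^sup>2 / 2"
      by (simp add: power2_eq_square algebra_simps)
  qed
  also have "\<dots> = (\<Sum>i = 0..int m. (W (i - 1))\<^sup>2) / 2 - (\<Sum>i = 0..int m. (W i)\<^sup>2)
      + (\<Sum>i = 0..int m. (W (i + 1))\<^sup>2) / 2"
    by (simp add: sum.distrib sum_subtractf sum_divide_distrib)
  also have "\<dots> \<le> 0"
    using sum_square_pred_le sum_square_succ_le by linarith
  finally show ?thesis .
qed

text \<open>For constant \<open>a\<close> the central difference is antisymmetric and the form
  telescopes away. A drop of \<open>D\<close> per cell leaves only
  \<open>D * (W (i - 1) * W i)\<close>, which Young's inequality and the shift bound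
  control.\<close>

lemma central_form_le:
  assumes a: "\<And>i. 0 \<le> i \<Longrightarrow> i \<le> int m \<Longrightarrow> a (i - 1) - a i = D" and D: "0 \<le> D"
  shows "(\<Sum>i = 0..int m. a i * W i * (W (i + 1) - W (i - 1))) \<le> D * (\<Sum>i = 0..int m. (W i)\<^sup>2)"
proof -
  define G where "G i = a (i - 1) * W (i - 1) * W i" for i
  have "(\<Sum>i = 0..int m. a i * W i * (W (i + 1) - W (i - 1)))
      \<le> (\<Sum>i = 0..int m. (G (i + 1) - G i) + D * ((W (i - 1))\<^sup>2 / 2 + (W i)\<^sup>2 / 2))"
  proof (rule sum_mono)
    fix i assume "i \<in> {0..int m}"
    then have ai: "a i = a (i - 1) - D" using a[of i] by simp
    have "(W i - W (i - 1))\<^sup>2 \<ge> 0" by simp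
    then have "D * (W (i - 1) * W i) \<le> D * ((W (i - 1))\<^sup>2 / 2 + (W i)\<^sup>2 / 2)"
      using D by (intro mult_left_mono) (auto simp: power2_eq_square algebra_simps)
    moreover have "a i * W i * (W (i + 1) - W (i - 1)) = (G (i + 1) - G i) + D * (W (i - 1) * W i)"
      unfolding G_def ai by (simp add: algebra_simps ai)
    ultimately show "a i * W i * (W (i + 1) - W (i - 1))
      \<le> (G (i + 1) - G i) + D * ((W (i - 1))\<^sup>2 / 2 + (W i)\<^sup>2 / 2)" by linarith
  qed
  also have "\<dots> = G (int m + 1) - G 0
      + D * ((\<Sum>i = 0..int m. (W (i - 1))\<^sup>2) / 2 + (\<Sum>i = 0..int m. (W i)\<^sup>2) / 2)"
    by (simp add: sum.distrib sum_telescope_int sum_divide_distrib flip: sum_distrib_left)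
  also have "G (int m + 1) - G 0 = 0"
    using zero[of "int m + 1"] zero[of "- 1"] by (simp add: G_def)
  also have "0 + D * ((\<Sum>i = 0..int m. (W (i - 1))\<^sup>2) / 2 + (\<Sum>i = 0..int m. (W i)\<^sup>2) / 2)
      \<le> D * (\<Sum>i = 0..int m. (W i)\<^sup>2)"
    using D sum_square_pred_le by (simp add: mult_left_mono)
  finally show ?thesis .
qed

text \<open>
  Up to a nonpositive multiple of the squared second difference, the summand is
  \<open>c i * (E (i + 1) - E i)\<close>; summation by parts moves the difference onto \<open>c\<close>.
\<close>
lemma third_difference_form_le:
  assumes c: "\<And>i. - 1 \<le> i \<Longrightarrow> i \<le> int m \<Longrightarrow> 0 \<le> c i"
    and cD: "\<And>i. 0 \<le> i \<Longrightarrow> i \<le> int m \<Longrightarrow> 0 \<le> c (i - 1) - c i \<and> c (i - 1) - c i \<le> D"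
  shows "(\<Sum>i = 0..int m. c i * W i * (- W (i + 2) + 3 * W (i + 1) - 3 * W i + W (i - 1)))
    \<le> 5 / 2 * D * (\<Sum>i = 0..int m. (W i)\<^sup>2)"
proof -
  \<comment> \<open>\<open>E\<close> is a discrete antiderivative: for \<open>c\<close> constantly 1
    the summand is \<open>E (i + 1) - E i\<close> minus half the squared second difference.\<close>
  define E where "E i = - W (i - 1) * W (i + 1) + W (i - 1) * W i + ((W i)\<^sup>2 - (W (i - 1))\<^sup>2) / 2"
    for i
  define G where "G i = c (i - 1) * E i" for i
  have D: "0 \<le> D" using cD[of 0] by simp
  have "(\<Sum>i = 0..int m. c i * W i * (- W (i + 2) + 3 * W (i + 1) - 3 * W i + W (i - 1)))
      \<le> (\<Sum>i = 0..int m. (G (i + 1) - G i)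
          + D * ((W (i - 1))\<^sup>2 + (W i)\<^sup>2 + (W (i + 1))\<^sup>2 / 2))"
  proof (rule sum_mono)
    fix i assume i: "i \<in> {0..int m}"
    \<comment> \<open>A diagonal majorant of the quadratic form \<open>E i\<close>, certified by the
      sum of squares below. Its coefficients 1, 1 and 1/2 add up to the constant 5/2.\<close>
    define F where "F = (W (i - 1))\<^sup>2 + (W i)\<^sup>2 + (W (i + 1))\<^sup>2 / 2"
    have "(W (i - 1) + W (i + 1))\<^sup>2 \<ge> 0" "(W i - W (i - 1))\<^sup>2 \<ge> 0" "(W (i - 1))\<^sup>2 \<ge> 0"
      by simp_all
    moreover have "F - E i = (W (i - 1) + W (i + 1))\<^sup>2 / 2 + (W i - W (i - 1))\<^sup>2 / 2 + (W (i - 1))\<^sup>2 / 2"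
      unfolding E_def F_def by (simp add: power2_eq_square field_simps)
    ultimately have "E i \<le> F" by linarith
    then have "(c (i - 1) - c i) * E i \<le> (c (i - 1) - c i) * F"
      using cD[of i] i by (intro mult_left_mono) auto
    also have "\<dots> \<le> D * F"
      using cD[of i] i by (intro mult_right_mono) (auto simp: F_def)
    finally have 1: "(c (i - 1) - c i) * E i \<le> D * F" .
    have "0 \<le> c i * ((W (i + 1) - 2 * W i + W (i - 1))\<^sup>2 / 2)"
      using c[of i] i by simp
    moreover have "c i * W i * (- W (i + 2) + 3 * W (i + 1) - 3 * W i + W (i - 1))
        = (G (i + 1) - G i) + (c (i - 1) - c i) * E i
          - c i * ((W (i + 1) - 2 * W i + W (i - 1))\<^sup>2 / 2)"
      unfolding G_def E_def by (simp add: field_simps power2_eq_square)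
    ultimately show "c i * W i * (- W (i + 2) + 3 * W (i + 1) - 3 * W i + W (i - 1))
      \<le> (G (i + 1) - G i) + D * ((W (i - 1))\<^sup>2 + (W i)\<^sup>2 + (W (i + 1))\<^sup>2 / 2)"
      using 1 unfolding F_def by linarith
  qed
  also have "\<dots> = G (int m + 1) - G 0
      + D * ((\<Sum>i = 0..int m. (W (i - 1))\<^sup>2) + (\<Sum>i = 0..int m. (W i)\<^sup>2)
        + (\<Sum>i = 0..int m. (W (i + 1))\<^sup>2) / 2)"
    by (simp add: sum.distrib sum_telescope_int sum_divide_distrib flip: sum_distrib_left)
  also have "\<dots> \<le> D * (5 / 2 * (\<Sum>i = 0..int m. (W i)\<^sup>2))"
  proof -
    \<comment> \<open>The zero values reduce \<open>E (int m + 1)\<close> to minus half the square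
      of \<open>W (int m)\<close>, and \<open>E 0\<close> to half the square of \<open>W 0\<close>.
      So both boundary terms have the favourable sign once \<open>c\<close> is nonnegative at
      \<open>int m\<close> and at \<open>- 1\<close>.\<close>
    have "G (int m + 1) \<le> 0" "G 0 \<ge> 0"
      using zero[of "int m + 1"] zero[of "int m + 1 + 1"] zero[of "- 1"] c[of "int m"] c[of "- 1"]
      by (simp_all add: G_def E_def)
    moreover have "D * ((\<Sum>i = 0..int m. (W (i - 1))\<^sup>2) + (\<Sum>i = 0..int m. (W i)\<^sup>2)
        + (\<Sum>i = 0..int m. (W (i + 1))\<^sup>2) / 2) \<le> D * (5 / 2 * (\<Sum>i = 0..int m. (W i)\<^sup>2))"
      using sum_square_pred_le sum_square_succ_le D by (intro mult_left_mono) linarith+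
    ultimately show ?thesis by linarith
  qed
  finally show ?thesis by simp
qed

end

text \<open>The reflection of the index about the middle of the grid exchanges the stencils for the
  two drift directions and turns an increasing coefficient into a decreasing one, so the previous
  lemma applies.\<close>

lemma third_difference_form_reflected_le:
  fixes W :: "int \<Rightarrow> real"
  assumes zero: "\<And>i. i < 0 \<or> i > int m \<Longrightarrow> W i = 0"
    and c: "\<And>i. 0 \<le> i \<Longrightarrow> i \<le> int m + 1 \<Longrightarrow> 0 \<le> c i"
    and cD: "\<And>i. 0 \<le> i \<Longrightarrow> i \<le> int m \<Longrightarrow> 0 \<le> c (i + 1) - c i \<and> c (i + 1) - c i \<le> D"
  shows "(\<Sum>i = 0..int m. c i * W i * (W (i + 1) - 3 * W i + 3 * W (i - 1) - W (i - 2)))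
    \<le> 5 / 2 * D * (\<Sum>i = 0..int m. (W i)\<^sup>2)"
proof -
  define U where "U i = W (int m - i)" for i
  define d where "d i = c (int m - i)" for i
  have refl: "(\<Sum>i = 0..int m. g (int m - i)) = (\<Sum>i = 0..int m. g i)" for g :: "int \<Rightarrow> real"
    by (rule sum.reindex_bij_witness[of _ "\<lambda>i. int m - i" "\<lambda>i. int m - i"]) auto
  have "(\<Sum>i = 0..int m. d i * U i * (- U (i + 2) + 3 * U (i + 1) - 3 * U i + U (i - 1)))
      \<le> 5 / 2 * D * (\<Sum>i = 0..int m. (U i)\<^sup>2)"
  proof (rule third_difference_form_le)
    show "U i = 0" if "i < 0 \<or> i > int m" for i
      using zero[of "int m - i"] that by (auto simp: U_def)
    show "0 \<le> d i" if "- 1 \<le> i" "i \<le> int m" for i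
      using c[of "int m - i"] that by (auto simp: d_def)
    show "0 \<le> d (i - 1) - d i \<and> d (i - 1) - d i \<le> D" if "0 \<le> i" "i \<le> int m" for i
      using cD[of "int m - i"] that by (simp add: d_def algebra_simps)
  qed
  moreover have "(\<Sum>i = 0..int m. d i * U i * (- U (i + 2) + 3 * U (i + 1) - 3 * U i + U (i - 1)))
      = (\<Sum>i = 0..int m. c i * W i * (W (i + 1) - 3 * W i + 3 * W (i - 1) - W (i - 2)))"
    by (subst refl[symmetric]) (simp add: U_def d_def algebra_simps)
  moreover have "(\<Sum>i = 0..int m. (U i)\<^sup>2) = (\<Sum>i = 0..int m. (W i)\<^sup>2)"
    unfolding U_def by (rule refl)
  ultimately show ?thesis by simp
qed

text \<open>The two upwind branches share the central part, so their central parts recombine to the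
  full coefficient \<open>a\<close>. What is left is \<open>- w 2\<close> times a third difference,
  with coefficient \<open>max (a i) 0\<close> or \<open>- min (a i) 0\<close>.\<close>

lemma drift_form_le:
  fixes W a w :: "int \<Rightarrow> real"
  assumes zero: "\<And>i. i < 0 \<or> i > int m \<Longrightarrow> W i = 0"
    and weights: "w (- 1) = - 1 / 2 - w 2" "w 0 = 3 * w 2" "w 1 = 1 / 2 - 3 * w 2" "w 2 \<le> 0"
    and a: "\<And>i. - 1 \<le> i \<Longrightarrow> i \<le> int m \<Longrightarrow> a (i + 1) = a i - D" and D: "0 \<le> D"
  shows "(\<Sum>i = 0..int m. W i *
      (max (a i) 0 * (w 2 * W (i + 2) + w 1 * W (i + 1) + w 0 * W i + w (- 1) * W (i - 1))
       + min (a i) 0 * (- w (- 1) * W (i + 1) - w 0 * W i - w 1 * W (i - 1) - w 2 * W (i - 2))))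
    \<le> (\<bar>w (- 1)\<bar> - 10 * w 2) * D * (\<Sum>i = 0..int m. (W i)\<^sup>2)"
    (is "?lhs \<le> _ * ?S")
proof -
  define C P Q where
    "C = (\<Sum>i = 0..int m. a i * W i * (W (i + 1) - W (i - 1)))"
    and "P = (\<Sum>i = 0..int m. max (a i) 0 * W i * (- W (i + 2) + 3 * W (i + 1) - 3 * W i + W (i - 1)))"
    and "Q = (\<Sum>i = 0..int m. - min (a i) 0 * W i * (W (i + 1) - 3 * W i + 3 * W (i - 1) - W (i - 2)))"
  have C: "C \<le> D * ?S"
    unfolding C_def
  proof (rule central_form_le[OF zero _ D])
    show "a (i - 1) - a i = D" if "0 \<le> i" "i \<le> int m" for i
      using a[of "i - 1"] that by simp
  qed
  have P: "P \<le> 5 / 2 * D * ?S"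
    unfolding P_def
  proof (rule third_difference_form_le[OF zero])
    \<comment> \<open>Truncation at zero preserves monotonicity and does not enlarge the steps of
      the coefficient.\<close>
    show "0 \<le> max (a (i - 1)) 0 - max (a i) 0 \<and> max (a (i - 1)) 0 - max (a i) 0 \<le> D"
      if "0 \<le> i" "i \<le> int m" for i
      using a[of "i - 1"] that D by (auto simp: max_def)
  qed auto
  have Q: "Q \<le> 5 / 2 * D * ?S"
    unfolding Q_def
  proof (rule third_difference_form_reflected_le[OF zero])
    show "0 \<le> - min (a (i + 1)) 0 - - min (a i) 0 \<and> - min (a (i + 1)) 0 - - min (a i) 0 \<le> D"
      if "0 \<le> i" "i \<le> int m" for i
      using a[of i] that D by (auto simp: min_def)
  qed auto
  have "?lhs = C / 2 + (- w 2) * P + (- w 2) * Q"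
  proof -
    have "W i *
      (max (a i) 0 * (w 2 * W (i + 2) + w 1 * W (i + 1) + w 0 * W i + w (- 1) * W (i - 1))
       + min (a i) 0 * (- w (- 1) * W (i + 1) - w 0 * W i - w 1 * W (i - 1) - w 2 * W (i - 2)))
      = a i * W i * (W (i + 1) - W (i - 1)) / 2
        + (- w 2) * (max (a i) 0 * W i * (- W (i + 2) + 3 * W (i + 1) - 3 * W i + W (i - 1)))
        + (- w 2) * (- min (a i) 0 * W i * (W (i + 1) - 3 * W i + 3 * W (i - 1) - W (i - 2)))" for i
    proof (cases "a i \<ge> 0")
      case True
      then show ?thesis unfolding weights(1-3) by (simp add: max_def min_def field_simps)
    next
      case False
      then show ?thesis unfolding weights(1-3) by (simp add: max_def min_def field_simps)
    qed
    then show ?thesis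
      unfolding C_def P_def Q_def
      by (simp only: sum.distrib sum_distrib_left sum_divide_distrib)
  qed
  also have "\<dots> \<le> D * ?S / 2 + (- w 2) * (5 / 2 * D * ?S) + (- w 2) * (5 / 2 * D * ?S)"
    using C P Q weights(4) by (intro add_mono mult_left_mono divide_right_mono) auto
  also have "\<dots> = (1 / 2 - 5 * w 2) * (D * ?S)"
    by (simp add: algebra_simps)
  \<comment> \<open>Since \<open>\<bar>w (- 1)\<bar>\<close> is at least \<open>1 / 2 + w 2\<close>,
    the right-hand factor is at least \<open>1 / 2 - 9 * w 2\<close>, which suffices as
    \<open>w 2 \<le> 0\<close>.\<close>
  also have "\<dots> \<le> (\<bar>w (- 1)\<bar> - 10 * w 2) * (D * ?S)"
    using weights D by (intro mult_right_mono mult_nonneg_nonneg sum_nonneg) auto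
  finally show ?thesis by (simp add: mult.assoc)
qed

subsection \<open>Cayley transform of a matrix bounded above\<close>

lemma scalar_prod_self_nonneg: "0 \<le> scalar_prod V (V :: real vec)"
  by (simp add: scalar_prod_def sum_nonneg)

lemma scalar_prod_self_pos:
  fixes V :: "real vec"
  assumes "V \<in> carrier_vec n" "V \<noteq> 0\<^sub>v n"
  shows "0 < scalar_prod V V"
proof -
  obtain k where k: "k < n" "V $ k \<noteq> 0"
    using assms by (metis carrier_vecD eq_vecI index_zero_vec)
  have "0 < (\<Sum>i = 0..<dim_vec V. V $ i * V $ i)"
    using k assms by (intro sum_pos2[of _ k]) (auto simp: zero_less_mult_iff)
  then show ?thesis by (simp add: scalar_prod_def)
qed

lemma grid_norm_scalar_prod: "grid_norm dx dy V = sqrt (dx * dy * scalar_prod V V)"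
  by (simp add: grid_norm_def grid_inner_def scalar_prod_def atLeast0LessThan)

text \<open>With \<open>Z\<close> the image of \<open>U\<close> under a matrix, the Cayley transform
  maps \<open>U - (1/2) \<cdot>\<^sub>v Z\<close> to \<open>U + (1/2) \<cdot>\<^sub>v Z\<close>, so
  this is its norm bound stated without an inverse.\<close>

lemma cayley_norm_le:
  fixes U Z :: "real vec"
  assumes U: "U \<in> carrier_vec N" and Z: "Z \<in> carrier_vec N"
    and UZ: "scalar_prod U Z \<le> 2 * h * scalar_prod U U" and h: "0 \<le> h" "h < 1"
  shows "scalar_prod (U + (1/2) \<cdot>\<^sub>v Z) (U + (1/2) \<cdot>\<^sub>v Z)
    \<le> ((1 + h) / (1 - h))\<^sup>2 * scalar_prod (U - (1/2) \<cdot>\<^sub>v Z) (U - (1/2) \<cdot>\<^sub>v Z)"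
proof -
  define p s z where "p = scalar_prod U U" and "s = scalar_prod U Z" and "z = scalar_prod Z Z"
  have comm: "scalar_prod Z U = s" using U Z by (simp add: s_def comm_scalar_prod)
  note distr = add_scalar_prod_distrib[of _ N] scalar_prod_add_distrib[of _ N]
    minus_scalar_prod_distrib[of _ N] scalar_prod_minus_distrib[of _ N]
    smult_scalar_prod_distrib[of _ N] scalar_prod_smult_distrib[of _ N]
  have plus: "scalar_prod (U + (1/2) \<cdot>\<^sub>v Z) (U + (1/2) \<cdot>\<^sub>v Z) = p + s + z / 4"
    using U Z comm by (simp add: distr field_simps flip: p_def s_def z_def)
  have minus: "scalar_prod (U - (1/2) \<cdot>\<^sub>v Z) (U - (1/2) \<cdot>\<^sub>v Z) = p - s + z / 4"
    using U Z comm by (simp add: distr field_simps flip: p_def s_def z_def)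
  have "scalar_prod (Z - (2 * h) \<cdot>\<^sub>v U) (Z - (2 * h) \<cdot>\<^sub>v U) = z - 4 * h * s + 4 * h\<^sup>2 * p"
    using U Z comm by (simp add: distr power2_eq_square algebra_simps flip: p_def s_def z_def)
  then have "0 \<le> h * (z - 4 * h * s + 4 * h\<^sup>2 * p)"
    using h scalar_prod_self_nonneg by (metis mult_nonneg_nonneg)
  moreover have "0 \<le> 2 * (1 - h\<^sup>2) * (2 * h * p - s)"
    using UZ h by (intro mult_nonneg_nonneg) (auto simp: p_def s_def abs_square_le_1)
  \<comment> \<open>The gap between the two sides is a sum of two nonnegative terms:
    \<open>h\<close> times the squared length of \<open>Z - (2 * h) \<cdot>\<^sub>v U\<close>, and a
    positive multiple of the slack in the one-sided bound.\<close>
  moreover have "(1 + h)\<^sup>2 * (p - s + z / 4) - (1 - h)\<^sup>2 * (p + s + z / 4)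
      = h * (z - 4 * h * s + 4 * h\<^sup>2 * p) + 2 * (1 - h\<^sup>2) * (2 * h * p - s)"
    by (simp add: power2_eq_square field_simps)
  ultimately have "(1 - h)\<^sup>2 * (p + s + z / 4) \<le> (1 + h)\<^sup>2 * (p - s + z / 4)"
    by linarith
  then show ?thesis
    unfolding plus minus using h by (simp add: power_divide field_simps)
qed

text \<open>Invertibility gives meaning to the \<open>the\<close> in \<open>cn_stability\<close>,
  and nonnegativity of the norm is what monotonicity of powers requires later.\<close>

lemma cn_stability_bound:
  fixes M :: "real mat"
  assumes M: "M \<in> carrier_mat N N" and N: "N > 0" and dxy: "dx > 0" "dy > 0"
    and diss: "\<And>V. V \<in> carrier_vec N \<Longrightarrow> scalar_prod V (M *\<^sub>v V) \<le> 2 * h * scalar_prod V V"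
    and h: "0 \<le> h" "h < 1"
  shows "invertible_mat (cn_denominator M)"
    and "0 \<le> spectral_norm dx dy (cn_stability M)"
    and "spectral_norm dx dy (cn_stability M) \<le> (1 + h) / (1 - h)"
proof -
  define X where "X = cn_denominator M"
  have X: "X \<in> carrier_mat N N" using M by (auto simp: X_def cn_denominator_def)
  have XU: "X *\<^sub>v U = U - (1/2) \<cdot>\<^sub>v (M *\<^sub>v U)" if "U \<in> carrier_vec N" for U
  proof -
    have "X = 1\<^sub>m N - (1/2) \<cdot>\<^sub>m M" using M by (simp add: X_def cn_denominator_def)
    then show ?thesis using that M
      by (simp add: minus_mult_distrib_mat_vec[of _ N N]) (auto simp: scalar_prod_def sum_distrib_left mult.assoc)
  qed
  \<comment> \<open>A kernel vector \<open>v\<close> would satisfy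
    \<open>scalar_prod v v \<le> h * scalar_prod v v\<close> with \<open>h < 1\<close>, hence
    vanish.\<close>
  have "det X \<noteq> 0"
  proof
    assume "det X = 0"
    then obtain v where v: "v \<in> carrier_vec N" "v \<noteq> 0\<^sub>v N" "X *\<^sub>v v = 0\<^sub>v N"
      using det_0_iff_vec_prod_zero[OF X] by auto
    have "scalar_prod v (X *\<^sub>v v) = scalar_prod v v - scalar_prod v (M *\<^sub>v v) / 2"
      using v(1) M by (simp add: XU scalar_prod_minus_distrib[of _ N])
    then have "scalar_prod v v = scalar_prod v (M *\<^sub>v v) / 2" using v by simp
    then have "scalar_prod v v \<le> h * scalar_prod v v" using diss[OF v(1)] by linarith
    then have "scalar_prod v v * (1 - h) \<le> 0" by (simp add: algebra_simps)
    with scalar_prod_self_pos[OF v(1,2)] h show False by (simp add: mult_le_0_iff)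
  qed
  then have "X \<in> Units (ring_mat TYPE(real) N ())" by (rule det_non_zero_imp_unit[OF X])
  then obtain Y where Y': "mat_inverse X = Some Y" using mat_inverse(1)[OF X, where b = "()"] by (cases "mat_inverse X") auto
  then have Y: "X * Y = 1\<^sub>m N" "Y * X = 1\<^sub>m N" "Y \<in> carrier_mat N N"
    using mat_inverse(2)[OF X] by auto
  show "invertible_mat (cn_denominator M)"
    using X Y by (auto simp: invertible_mat_def inverts_mat_def square_mat.simps simp flip: X_def intro!: exI[of _ Y])
  define R where "R = cn_stability M"
  have R: "R = Y * (1\<^sub>m N + (1/2) \<cdot>\<^sub>m M)"
    using Y' M by (simp add: R_def cn_stability_def flip: X_def)
  have Rc: "R \<in> carrier_mat N N" using Y M by (simp add: R)
  have ratio: "grid_norm dx dy (R *\<^sub>v V) / grid_norm dx dy V \<le> (1 + h) / (1 - h)"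
    if V: "V \<in> carrier_vec N - {0\<^sub>v N}" for V
  proof -
    \<comment> \<open>Parametrising \<open>V\<close> by its preimage under the denominator puts the
      quotient into the form treated by \<open>cayley_norm_le\<close>.\<close>
    define U where "U = Y *\<^sub>v V"
    define Z where "Z = M *\<^sub>v U"
    have Uc: "U \<in> carrier_vec N" and Zc: "Z \<in> carrier_vec N"
      using V Y M by (auto simp: U_def Z_def)
    have "X *\<^sub>v U = (X * Y) *\<^sub>v V" using X Y(3) V by (auto simp: U_def)
    then have VU: "V = U - (1/2) \<cdot>\<^sub>v Z"
      using V Y Uc by (simp add: XU Z_def)
    \<comment> \<open>The numerator is twice the identity minus the denominator, so
      \<open>R *\<^sub>v V\<close> becomes \<open>2 \<cdot>\<^sub>v U - V\<close> without commuting
      \<open>Y\<close> past \<open>M\<close>.\<close>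
    have "1\<^sub>m N + (1/2) \<cdot>\<^sub>m M = 2 \<cdot>\<^sub>m 1\<^sub>m N - X"
      using M by (auto simp: X_def cn_denominator_def)
    then have "R *\<^sub>v V = Y *\<^sub>v ((2 \<cdot>\<^sub>m 1\<^sub>m N - X) *\<^sub>v V)"
      using R Y X V M by (auto intro!: assoc_mult_mat_vec)
    also have "(2 \<cdot>\<^sub>m 1\<^sub>m N - X) *\<^sub>v V = 2 \<cdot>\<^sub>v V - X *\<^sub>v V"
      using X V by (auto simp: minus_mult_distrib_mat_vec[of _ N N])
    also have "Y *\<^sub>v (2 \<cdot>\<^sub>v V - X *\<^sub>v V) = 2 \<cdot>\<^sub>v U - (Y * X) *\<^sub>v V"
      using Y(3) X V by (auto simp: U_def mult_minus_distrib_mat_vec[of _ N N] mult_mat_vec[of _ N N])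
    also have "\<dots> = 2 \<cdot>\<^sub>v U - V" using Y V by simp
    also have "\<dots> = U + (1/2) \<cdot>\<^sub>v Z" unfolding VU using Uc Zc by auto
    finally have RV: "R *\<^sub>v V = U + (1/2) \<cdot>\<^sub>v Z" .
    have "scalar_prod (R *\<^sub>v V) (R *\<^sub>v V) \<le> ((1 + h) / (1 - h))\<^sup>2 * scalar_prod V V"
      using cayley_norm_le[OF Uc Zc _ h] diss[OF Uc] unfolding RV by (simp add: Z_def flip: VU[unfolded Z_def])
    then have "dx * dy * scalar_prod (R *\<^sub>v V) (R *\<^sub>v V)
        \<le> ((1 + h) / (1 - h))\<^sup>2 * (dx * dy * scalar_prod V V)"
      using dxy by (simp add: mult.left_commute)
    then have "grid_norm dx dy (R *\<^sub>v V) \<le> sqrt (((1 + h) / (1 - h))\<^sup>2 * (dx * dy * scalar_prod V V))"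
      unfolding grid_norm_scalar_prod by (rule real_sqrt_le_mono)
    also have "\<dots> = (1 + h) / (1 - h) * grid_norm dx dy V"
      using h by (simp add: grid_norm_scalar_prod real_sqrt_mult)
    finally have "grid_norm dx dy (R *\<^sub>v V) \<le> (1 + h) / (1 - h) * grid_norm dx dy V" .
    moreover have "grid_norm dx dy V > 0"
      using V dxy scalar_prod_self_pos[of V N] by (simp add: grid_norm_scalar_prod)
    ultimately show ?thesis by (simp add: pos_divide_le_eq)
  qed
  \<comment> \<open>A witness that the supremum defining the spectral norm ranges over a nonempty
    set; \<open>ratio\<close> supplies the upper bound.\<close>
  have "unit_vec N 0 \<in> carrier_vec N - {0\<^sub>v N :: real vec}"
    using N by (auto dest: arg_cong[where f = "\<lambda>v. v $ 0"])
  then obtain e :: "real vec" where e: "e \<in> carrier_vec N - {0\<^sub>v N}" by blast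
  have S: "spectral_norm dx dy R
      = (SUP V \<in> carrier_vec N - {0\<^sub>v N}. grid_norm dx dy (R *\<^sub>v V) / grid_norm dx dy V)"
    using Rc by (simp add: spectral_norm_def)
  have "0 \<le> grid_norm dx dy (R *\<^sub>v e) / grid_norm dx dy e"
    using dxy scalar_prod_self_nonneg by (simp add: grid_norm_scalar_prod)
  also have "\<dots> \<le> spectral_norm dx dy R"
    unfolding S by (intro cSUP_upper e bdd_aboveI2[of _ _ "(1 + h) / (1 - h)"] ratio)
  finally show "0 \<le> spectral_norm dx dy (cn_stability M)" by (simp add: R_def)
  show "spectral_norm dx dy (cn_stability M) \<le> (1 + h) / (1 - h)"
    using e ratio unfolding R_def[symmetric] S by (intro cSUP_least) auto
qed

text \<open>On this range \<open>1 / (1 - h)\<close> is at most \<open>1 + 2 * h\<close>, and both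
  resulting factors are at most \<open>exp (2 * h)\<close>.\<close>

lemma cayley_le_exp:
  fixes h :: real
  assumes "0 \<le> h" "h \<le> 1/2"
  shows "(1 + h) / (1 - h) \<le> exp (4 * h)"
proof -
  have "h * h \<le> h * (1/2)" using assms by (intro mult_left_mono) auto
  then have "1 / (1 - h) \<le> 1 + 2 * h"
    using assms by (simp add: field_simps)
  then have "(1 + h) / (1 - h) \<le> (1 + h) * (1 + 2 * h)"
    using assms mult_left_mono[of "1 / (1 - h)" "1 + 2 * h" "1 + h"] by simp
  also have "\<dots> \<le> exp (2 * h) * exp (2 * h)"
  proof (rule mult_mono)
    show "1 + h \<le> exp (2 * h)" "1 + 2 * h \<le> exp (2 * h)"
      using assms exp_ge_add_one_self[of "2 * h"] by linarith+
  qed (use assms in auto)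
  also have "\<dots> = exp (4 * h)" by (simp flip: exp_add)
  finally show ?thesis .
qed

subsection \<open>The jump term\<close>

lemma uniform_grid_node:
  assumes grid: "uniform_grid lo hi m h x" and "k \<le> Suc m"
  shows "x (int k) = lo + real (Suc k) * h"
  using assms(2)
proof (induction k)
  case 0
  have lo: "x (- 1) = lo" and steps: "\<forall>i \<in> {- 1..int m}. x (i + 1) - x i = h"
    using grid by (simp_all add: uniform_grid_def)
  from bspec[OF steps, of "- 1"] lo show ?case by simp
next
  case (Suc k)
  have "x (int k + 1) - x (int k) = h"
    using grid Suc.prems by (auto simp: uniform_grid_def)
  with Suc show ?case by (simp add: algebra_simps)
qed

text \<open>The nodes \<open>- 1\<close> to \<open>m + 1\<close> bound \<open>m + 2\<close>
  cells.\<close>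

lemma uniform_grid_width:
  assumes "uniform_grid lo hi m h x"
  shows "hi - lo = real (m + 2) * h"
  using uniform_grid_node[OF assms, of "Suc m"] assms by (simp add: uniform_grid_def algebra_simps)

section \<open>The jump density and its integrals over grid cells\<close>

lemma sup_norm_upper:
  assumes "bounded (range f)"
  shows "f \<xi> \<le> sup_norm f"
proof -
  from assms obtain C where "\<And>\<xi>. \<bar>f \<xi>\<bar> \<le> C" by (auto simp: bounded_iff)
  then have "\<bar>f \<xi>\<bar> \<le> sup_norm f"
    unfolding sup_norm_def by (intro cSUP_upper bdd_aboveI2) auto
  then show ?thesis by linarith
qed

text \<open>A density that vanishes everywhere would have integral 0. Positivity allows division by
  the Schur weight in \<open>jump_form_le\<close>.\<close>

lemma sup_norm_density_pos:
  assumes "prob_density f" "bounded (range f)"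
  shows "0 < sup_norm f"
proof (rule ccontr)
  assume "\<not> 0 < sup_norm f"
  then have "f \<xi> = 0" for \<xi>
    using sup_norm_upper[OF assms(2), of \<xi>] assms(1) unfolding prob_density_def
    by (metis dual_order.trans linorder_not_less order_antisym)
  then have "f = (\<lambda>_. 0)" by auto
  then show False using assms(1) by (simp add: prob_density_def)
qed

lemma prob_density_shift:
  assumes "prob_density f"
  shows "prob_density (\<lambda>\<xi>. f (\<xi> - c))"
  using assms lebesgue_integrable_real_affine[of f 1 "- c"]
    lebesgue_integral_real_affine[of 1 f "- c"]
  by (simp add: prob_density_def)

text \<open>Passing to Henstock-Kurzweil integrals lets adjacent closed cells be glued at their
  common endpoint. The ordering is part of the claim because the induction needs it for each
  gluing.\<close>

lemma sum_set_integral_cells: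
  fixes g :: "real \<Rightarrow> real" and y :: "int \<Rightarrow> real"
  assumes g: "integrable lebesgue g" and y: "\<And>l. - 1 \<le> l \<Longrightarrow> l < int n \<Longrightarrow> y l \<le> y (l + 1)"
  shows "y (- 1) \<le> y (int n) \<and>
    (\<Sum>l = - 1..int n - 1. LINT \<xi>:{y l..y (l + 1)}|lebesgue. g \<xi>)
      = (LINT \<xi>:{y (- 1)..y (int n)}|lebesgue. g \<xi>)"
proof -
  have "g absolutely_integrable_on UNIV" using g by (simp add: set_integrable_def)
  then have abs: "g absolutely_integrable_on {a..b}" for a b
    by (rule set_integrable_subset) auto
  note int = set_lebesgue_integral_eq_integral[OF abs]
  show ?thesis
    unfolding int(2) using y
  proof (induction n)
    case 0
    from "0.prems"[of "- 1"] show ?case by simp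
  next
    case (Suc n)
    have IH: "y (- 1) \<le> y (int n)" "(\<Sum>l = - 1..int n - 1. integral {y l..y (l + 1)} g)
        = integral {y (- 1)..y (int n)} g"
      using Suc by auto
    have le: "y (int n) \<le> y (int n + 1)" using Suc.prems[of "int n"] by simp
    have "{- 1..int (Suc n) - 1} = insert (int n) {- 1..int n - 1}" by auto
    then show ?case
      using IH le Henstock_Kurzweil_Integration.integral_combine[OF IH(1) le int(1)]
      by (simp add: add.commute)
  qed
qed

text \<open>One half of a hat function is a triangle of base \<open>h\<close> and height 1; this and
  the next lemma yield the \<open>h / 2\<close> in the entry bounds of the quadrature.\<close>

lemma has_integral_hat_left:
  assumes "(0::real) < h"
  shows "((\<lambda>\<xi>. (a + h - \<xi>) / h) has_integral h / 2) {a..a + h}"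
proof -
  have "((\<lambda>\<xi>. (a + h - \<xi>) / h) has_integral
      - ((a + h) - (a + h))\<^sup>2 / (2 * h) - - ((a + h) - a)\<^sup>2 / (2 * h)) {a..a + h}"
    using assms
    by (intro fundamental_theorem_of_calculus)
      (auto intro!: derivative_eq_intros simp: field_simps
        simp flip: has_real_derivative_iff_has_vector_derivative)
  then show ?thesis using assms by (simp add: power2_eq_square)
qed

lemma has_integral_hat_right:
  assumes "(0::real) < h"
  shows "((\<lambda>\<xi>. (\<xi> - a) / h) has_integral h / 2) {a..a + h}"
proof -
  have "((\<lambda>\<xi>. (\<xi> - a) / h) has_integral
      ((a + h) - a)\<^sup>2 / (2 * h) - (a - a)\<^sup>2 / (2 * h)) {a..a + h}"
    using assms
    by (intro fundamental_theorem_of_calculus)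
      (auto intro!: derivative_eq_intros simp: field_simps
        simp flip: has_real_derivative_iff_has_vector_derivative)
  then show ?thesis using assms by (simp add: power2_eq_square)
qed

text \<open>Bounds one quadrature weight by the mass of the hat function times the supremum of the
  density.\<close>

lemma weighted_set_integral_bounds:
  fixes g \<phi> :: "real \<Rightarrow> real"
  assumes int: "set_integrable lebesgue S (\<lambda>\<xi>. \<phi> \<xi> * g \<xi>)"
    and \<phi>: "(\<phi> has_integral c) S" "\<And>\<xi>. \<xi> \<in> S \<Longrightarrow> 0 \<le> \<phi> \<xi>"
    and g: "\<And>\<xi>. 0 \<le> g \<xi>" "\<And>\<xi>. g \<xi> \<le> F"
  shows "0 \<le> (LINT \<xi>:S|lebesgue. \<phi> \<xi> * g \<xi>)" "(LINT \<xi>:S|lebesgue. \<phi> \<xi> * g \<xi>) \<le> c * F"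
proof -
  note I = set_lebesgue_integral_eq_integral[OF int]
  have hF: "((\<lambda>\<xi>. \<phi> \<xi> * F) has_integral c * F) S"
    using \<phi>(1) by (rule has_integral_mult_left)
  show "0 \<le> (LINT \<xi>:S|lebesgue. \<phi> \<xi> * g \<xi>)"
    unfolding I(2) using I(1) \<phi> g by (intro Henstock_Kurzweil_Integration.integral_nonneg) auto
  show "(LINT \<xi>:S|lebesgue. \<phi> \<xi> * g \<xi>) \<le> c * F"
    unfolding I(2)
    using has_integral_le[OF integrable_integral[OF I(1)] hF] \<phi>(2) g by (simp add: mult_left_mono)
qed

text \<open>
  A Schur test: the quadrature weights have row sums at most \<open>1\<close>, because \<open>f\<close> is a
  probability density, and column sums at most \<open>(hi - lo) * sup_norm f\<close>.
\<close>
lemma jump_form_le: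
  fixes W y :: "int \<Rightarrow> real"
  assumes zero: "\<And>j. j < 0 \<or> j > int m \<Longrightarrow> W j = 0"
    and grid: "uniform_grid lo hi m h y"
    and f: "prob_density f" "bounded (range f)"
  shows "(\<Sum>j = 0..int m. W j * (\<Sum>l = - 1..int m. LINT \<xi>:{y l..y (l + 1)}|lebesgue.
        ((y (l + 1) - \<xi>) / h * W l + (\<xi> - y l) / h * W (l + 1)) * f (\<xi> - y j)))
    \<le> sqrt ((hi - lo) * sup_norm f) * (\<Sum>j = 0..int m. (W j)\<^sup>2)"
proof -
  define F s S where "F = sup_norm f" and "s = sqrt ((hi - lo) * F)"
    and "S = (\<Sum>j = 0..int m. (W j)\<^sup>2)"
  \<comment> \<open>\<open>P\<close> and \<open>Q\<close> are the weights that cell \<open>l\<close>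
    gives to its left and right endpoint in row \<open>j\<close>.\<close>
  define P where "P j l = (LINT \<xi>:{y l..y (l + 1)}|lebesgue. (y (l + 1) - \<xi>) / h * f (\<xi> - y j))"
    for j l
  define Q where "Q j l = (LINT \<xi>:{y l..y (l + 1)}|lebesgue. (\<xi> - y l) / h * f (\<xi> - y j))"
    for j l
  have h: "0 < h" and cell: "- 1 \<le> l \<Longrightarrow> l \<le> int m \<Longrightarrow> y (l + 1) - y l = h" for l
    using grid by (auto simp: uniform_grid_def)
  have F: "0 < F" "f \<xi> \<le> F" "0 \<le> f \<xi>" for \<xi>
    using f sup_norm_density_pos sup_norm_upper by (auto simp: F_def prob_density_def)
  have "0 < hi - lo" using uniform_grid_width[OF grid] h by simp
  then have s: "0 < s" "s\<^sup>2 = (hi - lo) * F" using F(1) by (simp_all add: s_def)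
  have f_int: "integrable lebesgue f" using f(1) by (simp add: prob_density_def)
  have Pint: "set_integrable lebesgue {a..b} (\<lambda>\<xi>. (b - \<xi>) / h * f (\<xi> - c))" for a b c
    using jump_integrand_integrable[OF f_int, where p = 1 and q = 0] by simp
  have Qint: "set_integrable lebesgue {a..b} (\<lambda>\<xi>. (\<xi> - a) / h * f (\<xi> - c))" for a b c
    using jump_integrand_integrable[OF f_int, where p = 0 and q = 1] by simp
  have split: "(LINT \<xi>:{y l..y (l + 1)}|lebesgue.
      ((y (l + 1) - \<xi>) / h * p + (\<xi> - y l) / h * q) * f (\<xi> - y j)) = P j l * p + Q j l * q"
    for j l p q
  proof -
    have "((y (l + 1) - \<xi>) / h * p + (\<xi> - y l) / h * q) * f (\<xi> - y j)
      = p * ((y (l + 1) - \<xi>) / h * f (\<xi> - y j)) + q * ((\<xi> - y l) / h * f (\<xi> - y j))" for \<xi>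
      by (simp add: algebra_simps add_divide_distrib)
    then have "(LINT \<xi>:{y l..y (l + 1)}|lebesgue.
        ((y (l + 1) - \<xi>) / h * p + (\<xi> - y l) / h * q) * f (\<xi> - y j)) = p * P j l + q * Q j l"
      unfolding P_def Q_def using Pint Qint
      by (simp only: set_integral_add set_integral_mult_right set_integrable_mult_right)
    then show ?thesis by (simp add: mult.commute)
  qed
  have PQ: "0 \<le> P j l" "P j l \<le> h / 2 * F" "0 \<le> Q j l" "Q j l \<le> h / 2 * F"
    if l: "- 1 \<le> l" "l \<le> int m" for j l
  proof -
    have yl: "y (l + 1) = y l + h" using cell[OF l] by simp
    note g = F(3) F(2)
    show "0 \<le> P j l" "P j l \<le> h / 2 * F"
      unfolding P_def yl
      by (rule weighted_set_integral_bounds[OF Pint has_integral_hat_left[OF h] _ g]; use h in simp)+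
    show "0 \<le> Q j l" "Q j l \<le> h / 2 * F"
      unfolding Q_def yl
      by (rule weighted_set_integral_bounds[OF Qint has_integral_hat_right[OF h] _ g]; use h in simp)+
  qed
  \<comment> \<open>The two hat functions on a cell add up to 1, so a row sum is the integral of a
    shifted density over the grid interval.\<close>
  have row: "(\<Sum>l = - 1..int m. P j l + Q j l) \<le> 1" for j
  proof -
    define g where "g \<xi> = f (\<xi> - y j)" for \<xi>
    have g: "prob_density g" unfolding g_def by (rule prob_density_shift[OF f(1)])
    then have gi: "integrable lebesgue g" by (simp add: prob_density_def)
    have "(\<Sum>l = - 1..int m. P j l + Q j l)
        = (\<Sum>l = - 1..int (Suc m) - 1. LINT \<xi>:{y l..y (l + 1)}|lebesgue. g \<xi>)"
    proof (rule sum.cong)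
      fix l assume "l \<in> {- 1..int (Suc m) - 1}"
      then have l: "y (l + 1) - y l = h" using cell by simp
      have "(y (l + 1) - \<xi>) / h + (\<xi> - y l) / h = 1" for \<xi>
        using l h by (simp flip: add_divide_distrib)
      then show "P j l + Q j l = (LINT \<xi>:{y l..y (l + 1)}|lebesgue. g \<xi>)"
        using split[of l 1 1 j] by (simp add: g_def)
    qed simp
    also have "\<dots> = (LINT \<xi>:{y (- 1)..y (int (Suc m))}|lebesgue. g \<xi>)"
      using cell h by (intro conjunct2[OF sum_set_integral_cells] gi) force
    also have "\<dots> \<le> (LINT \<xi>|lebesgue. g \<xi>)"
      unfolding set_lebesgue_integral_def using g
      by (intro integral_mono integrable_mult_indicator gi)
        (auto simp: prob_density_def indicator_def)
    also have "\<dots> = 1" using g by (simp add: prob_density_def)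
    finally show ?thesis .
  qed
  \<comment> \<open>Young's inequality weighted by \<open>s\<close>, the value at which row and
    column contributions balance.\<close>
  have young: "p * q \<le> (s * p\<^sup>2 + q\<^sup>2 / s) / 2" for p q :: real
  proof -
    have "0 \<le> (s * p - q)\<^sup>2 / s" using s by simp
    also have "\<dots> = s * p\<^sup>2 + q\<^sup>2 / s - 2 * (p * q)"
      using s by (simp add: power2_eq_square field_simps)
    finally show ?thesis by simp
  qed
  have sums: "(\<Sum>l = - 1..int m. (W l)\<^sup>2) = S" "(\<Sum>l = - 1..int m. (W (l + 1))\<^sup>2) = S"
  proof -
    show "(\<Sum>l = - 1..int m. (W l)\<^sup>2) = S"
      unfolding S_def using zero by (intro sum.mono_neutral_right) auto
    have "(\<Sum>l = - 1..int m. (W (l + 1))\<^sup>2) = (\<Sum>l = 0..int m + 1. (W l)\<^sup>2)"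
      by (rule sum.reindex_bij_witness[of _ "\<lambda>l. l - 1" "\<lambda>l. l + 1"]) auto
    also have "\<dots> = S"
      unfolding S_def using zero by (intro sum.mono_neutral_right) auto
    finally show "(\<Sum>l = - 1..int m. (W (l + 1))\<^sup>2) = S" .
  qed
  \<comment> \<open>On the row part the exact weights are kept for \<open>row\<close>; on the column
    part they are replaced by their uniform bound \<open>h / 2 * F\<close>.\<close>
  have entry: "W j * (P j l * W l + Q j l * W (l + 1))
      \<le> s / 2 * (W j)\<^sup>2 * (P j l + Q j l) + h * F / (4 * s) * ((W l)\<^sup>2 + (W (l + 1))\<^sup>2)"
    if l: "- 1 \<le> l" "l \<le> int m" for j l
  proof -
    define u v where "u = (W l)\<^sup>2 / s" and "v = (W (l + 1))\<^sup>2 / s"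
    have "W j * (P j l * W l + Q j l * W (l + 1)) = P j l * (W j * W l) + Q j l * (W j * W (l + 1))"
      by (simp add: distrib_left mult.left_commute)
    also have "\<dots> \<le> P j l * ((s * (W j)\<^sup>2 + u) / 2) + Q j l * ((s * (W j)\<^sup>2 + v) / 2)"
      unfolding u_def v_def by (intro add_mono mult_left_mono young PQ[OF l])
    also have "\<dots> = s / 2 * (W j)\<^sup>2 * (P j l + Q j l) + (P j l * u + Q j l * v) / 2"
      by (simp add: field_simps)
    also have "P j l * u + Q j l * v \<le> h / 2 * F * u + h / 2 * F * v"
      using s(1) by (intro add_mono mult_right_mono PQ[OF l]; simp add: u_def v_def)
    also have "(h / 2 * F * u + h / 2 * F * v) / 2
        = h * F / (4 * s) * ((W l)\<^sup>2 + (W (l + 1))\<^sup>2)"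
      by (simp add: u_def v_def add_divide_distrib distrib_left)
    finally show ?thesis by simp
  qed
  have "(\<Sum>j = 0..int m. W j * (\<Sum>l = - 1..int m. P j l * W l + Q j l * W (l + 1)))
      \<le> (\<Sum>j = 0..int m. s / 2 * (W j)\<^sup>2 + h * F / (4 * s) * (S + S))"
  proof (rule sum_mono)
    fix j
    have "W j * (\<Sum>l = - 1..int m. P j l * W l + Q j l * W (l + 1))
      \<le> (\<Sum>l = - 1..int m. s / 2 * (W j)\<^sup>2 * (P j l + Q j l)
          + h * F / (4 * s) * ((W l)\<^sup>2 + (W (l + 1))\<^sup>2))"
      unfolding sum_distrib_left using entry by (intro sum_mono) auto
    also have "\<dots> = s / 2 * (W j)\<^sup>2 * (\<Sum>l = - 1..int m. P j l + Q j l)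
        + h * F / (4 * s) * ((\<Sum>l = - 1..int m. (W l)\<^sup>2) + (\<Sum>l = - 1..int m. (W (l + 1))\<^sup>2))"
      by (simp only: sum.distrib flip: sum_distrib_left)
    also have "\<dots> \<le> s / 2 * (W j)\<^sup>2 * 1 + h * F / (4 * s) * (S + S)"
      unfolding sums using row s by (intro add_right_mono mult_left_mono) auto
    finally show "W j * (\<Sum>l = - 1..int m. P j l * W l + Q j l * W (l + 1))
      \<le> s / 2 * (W j)\<^sup>2 + h * F / (4 * s) * (S + S)" by simp
  qed
  also have "\<dots> = s / 2 * S + real (m + 1) * (h * F / (4 * s) * (S + S))"
    unfolding sum.distrib sum_distrib_left[symmetric] S_def[symmetric] by simp
  also have "real (m + 1) * (h * F / (4 * s) * (S + S)) = (real (m + 1) * h) * F * S / (2 * s)"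
    using s(1) by (simp add: field_simps)
  \<comment> \<open>The \<open>m + 1\<close> rows contribute one cell width each, one less than the
    \<open>m + 2\<close> cells of the interval.\<close>
  also have "s / 2 * S + (real (m + 1) * h) * F * S / (2 * s) \<le> s / 2 * S + (hi - lo) * F * S / (2 * s)"
  proof -
    have "real (m + 1) * h \<le> hi - lo"
      unfolding uniform_grid_width[OF grid] using h by (intro mult_right_mono) auto
    moreover have "0 \<le> S" by (simp add: S_def sum_nonneg)
    ultimately show ?thesis
      using s F(1) by (intro add_left_mono divide_right_mono mult_right_mono) auto
  qed
  \<comment> \<open>As the square of \<open>s\<close> is \<open>(hi - lo) * F\<close>, the row and
    column parts both equal \<open>s / 2 * S\<close>.\<close>
  also have "\<dots> = s * S"
    unfolding s(2)[symmetric] using s(1) by (simp add: power2_eq_square)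
  finally show ?thesis by (simp only: split s_def S_def F_def)
qed

subsection \<open>The two-dimensional scheme\<close>

lemma dirichlet_ext_index:
  assumes "i \<le> m1" "j \<le> m2"
  shows "dirichlet_ext m1 m2 V (int i) (int j) = V $ (i * (m2 + 1) + j)"
  using assms by (simp add: dirichlet_ext_def)

text \<open>The row-major numbering splits the index range into \<open>m1 + 1\<close> consecutive
  blocks of length \<open>m2 + 1\<close>.\<close>

lemma scalar_prod_grid:
  fixes V X :: "real vec"
  assumes "X \<in> carrier_vec (num_unknowns m1 m2)"
  shows "scalar_prod V X = (\<Sum>i = 0..int m1. \<Sum>j = 0..int m2.
    dirichlet_ext m1 m2 V i j * dirichlet_ext m1 m2 X i j)"
proof -
  define n where "n = Suc m2"
  define g where "g k = V $ k * X $ k" for k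
  have "scalar_prod V X = (\<Sum>k<Suc m1 * n. g k)"
    using assms by (simp add: scalar_prod_def num_unknowns_def atLeast0LessThan n_def g_def)
  also have "\<dots> = (\<Sum>i<Suc m1. \<Sum>k = i * n..<i * n + n. g k)"
    by (rule sum.nat_group[symmetric])
  also have "\<dots> = (\<Sum>i<Suc m1. \<Sum>j<n. g (i * n + j))"
  proof (rule sum.cong)
    show "(\<Sum>k = i * n..<i * n + n. g k) = (\<Sum>j<n. g (i * n + j))" for i
      using sum.shift_bounds_nat_ivl[of g 0 "i * n" n] by (simp add: atLeast0LessThan add.commute)
  qed simp
  also have "\<dots> = (\<Sum>i<Suc m1. \<Sum>j<n.
      dirichlet_ext m1 m2 V (int i) (int j) * dirichlet_ext m1 m2 X (int i) (int j))"
    by (intro sum.cong refl) (simp only: dirichlet_ext_index lessThan_iff less_Suc_eq_le n_def g_def Suc_eq_plus1_left add.commute)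
  finally show ?thesis by (simp only: sum_int_interval_eq_nat n_def)
qed

text \<open>Each stencil acts along a single direction, so the one-dimensional bounds are applied
  line by line and summed. The drift drops by \<open>\<alpha> * dx\<close> or
  \<open>\<beta> * dy\<close> per cell, which cancels the mesh width in the difference quotient and
  makes the bound independent of the mesh.\<close>

lemma diff_form_le:
  fixes W :: "int \<Rightarrow> int \<Rightarrow> real"
  assumes zero: "\<And>i j. i < 0 \<or> i > int m1 \<or> j < 0 \<or> j > int m2 \<Longrightarrow> W i j = 0"
    and weights: "(\<Sum>k = - 1..2. w k) = 0" "(\<Sum>k = - 1..2. of_int k * w k) = 1"
      "(\<Sum>k = - 1..2. (of_int k)\<^sup>2 * w k) = 0" "w 2 \<le> 0"
    and grids: "uniform_grid xmin xmax m1 dx x" "uniform_grid ymin ymax m2 dy y"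
    and pos: "0 \<le> \<alpha>" "0 \<le> \<beta>"
  shows "(\<Sum>i = 0..int m1. \<Sum>j = 0..int m2. W i j * diff_op \<alpha> \<mu> \<beta> \<sigma> r lam w x y dx dy W i j)
    \<le> ((\<bar>w (- 1)\<bar> - 10 * w 2) * (\<alpha> + \<beta>) - (r + lam))
        * (\<Sum>i = 0..int m1. \<Sum>j = 0..int m2. (W i j)\<^sup>2)"
proof -
  define K where "K = \<bar>w (- 1)\<bar> - 10 * w 2"
  define S where "S = (\<Sum>i = 0..int m1. \<Sum>j = 0..int m2. (W i j)\<^sup>2)"
  define a b where "a i = \<alpha> * (\<mu> - x i)" and "b j = - \<beta> * y j" for i j
  define L where "L i j = W i j * (W (i - 1) j - 2 * W i j + W (i + 1) j)" for i j
  define X where "X i j = W i j *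
      (max (a i) 0 * (w 2 * W (i + 2) j + w 1 * W (i + 1) j + w 0 * W i j + w (- 1) * W (i - 1) j)
       + min (a i) 0 * (- w (- 1) * W (i + 1) j - w 0 * W i j - w 1 * W (i - 1) j - w 2 * W (i - 2) j))"
    for i j
  define Y where "Y i j = W i j *
      (max (b j) 0 * (w 2 * W i (j + 2) + w 1 * W i (j + 1) + w 0 * W i j + w (- 1) * W i (j - 1))
       + min (b j) 0 * (- w (- 1) * W i (j + 1) - w 0 * W i j - w 1 * W i (j - 1) - w 2 * W i (j - 2)))"
    for i j
  note ws = weights_solve[OF weights(1-3)]
  have dx: "0 < dx" "\<And>i. - 1 \<le> i \<Longrightarrow> i \<le> int m1 \<Longrightarrow> x (i + 1) - x i = dx"
    and dy: "0 < dy" "\<And>j. - 1 \<le> j \<Longrightarrow> j \<le> int m2 \<Longrightarrow> y (j + 1) - y j = dy"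
    using grids by (auto simp: uniform_grid_def)
  have L: "(\<Sum>i = 0..int m1. L i j) \<le> 0" for j
    unfolding L_def by (rule diffusion_form_nonpos, rule zero) auto
  have X: "(\<Sum>i = 0..int m1. X i j) \<le> K * (\<alpha> * dx) * (\<Sum>i = 0..int m1. (W i j)\<^sup>2)" for j
    unfolding X_def K_def
  proof (rule drift_form_le[OF _ ws weights(4)])
    show "a (i + 1) = a i - \<alpha> * dx" if "- 1 \<le> i" "i \<le> int m1" for i
    proof -
      have "x (i + 1) = x i + dx" using dx(2)[OF that] by simp
      then show ?thesis by (simp add: a_def algebra_simps)
    qed
  qed (use zero pos dx in auto)
  have Y: "(\<Sum>j = 0..int m2. Y i j) \<le> K * (\<beta> * dy) * (\<Sum>j = 0..int m2. (W i j)\<^sup>2)" for i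
    unfolding Y_def K_def
  proof (rule drift_form_le[OF _ ws weights(4)])
    show "b (j + 1) = b j - \<beta> * dy" if "- 1 \<le> j" "j \<le> int m2" for j
    proof -
      have "y (j + 1) = y j + dy" using dy(2)[OF that] by simp
      then show ?thesis by (simp add: b_def algebra_simps)
    qed
  qed (use zero pos dy in auto)
  have "(\<Sum>i = 0..int m1. \<Sum>j = 0..int m2. L i j) \<le> 0"
    by (subst sum.swap) (intro sum_nonpos L)
  then have L': "\<sigma>\<^sup>2 / 2 / dx\<^sup>2 * (\<Sum>i = 0..int m1. \<Sum>j = 0..int m2. L i j) \<le> 0"
    by (intro mult_nonneg_nonpos) auto
  have "(\<Sum>i = 0..int m1. \<Sum>j = 0..int m2. X i j)
      \<le> (\<Sum>j = 0..int m2. K * (\<alpha> * dx) * (\<Sum>i = 0..int m1. (W i j)\<^sup>2))"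
    by (subst sum.swap) (intro sum_mono X)
  also have "\<dots> = K * \<alpha> * S * dx"
    unfolding S_def sum.swap[of _ "{0..int m2}"] by (simp flip: sum_distrib_left)
  finally have X': "1 / dx * (\<Sum>i = 0..int m1. \<Sum>j = 0..int m2. X i j) \<le> K * \<alpha> * S"
    using dx(1) by (simp add: pos_divide_le_eq)
  have "(\<Sum>i = 0..int m1. \<Sum>j = 0..int m2. Y i j)
      \<le> (\<Sum>i = 0..int m1. K * (\<beta> * dy) * (\<Sum>j = 0..int m2. (W i j)\<^sup>2))"
    by (intro sum_mono Y)
  also have "\<dots> = K * \<beta> * S * dy"
    unfolding S_def by (simp flip: sum_distrib_left)
  finally have Y': "1 / dy * (\<Sum>i = 0..int m1. \<Sum>j = 0..int m2. Y i j) \<le> K * \<beta> * S"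
    using dy(1) by (simp add: pos_divide_le_eq)
  \<comment> \<open>Proved for arbitrary reals so that the stencils stay opaque and are not
    multiplied out.\<close>
  have regroup: "u * (\<sigma>\<^sup>2 / 2 * (l / dx\<^sup>2) - c * u + a\<^sub>1 * (p\<^sub>1 / dx) + a\<^sub>2 * (p\<^sub>2 / dx)
        + b\<^sub>1 * (q\<^sub>1 / dy) + b\<^sub>2 * (q\<^sub>2 / dy))
      = \<sigma>\<^sup>2 / 2 / dx\<^sup>2 * (u * l) - c * u\<^sup>2 + 1 / dx * (u * (a\<^sub>1 * p\<^sub>1 + a\<^sub>2 * p\<^sub>2))
        + 1 / dy * (u * (b\<^sub>1 * q\<^sub>1 + b\<^sub>2 * q\<^sub>2))"
    for u l c a\<^sub>1 a\<^sub>2 b\<^sub>1 b\<^sub>2 p\<^sub>1 p\<^sub>2 q\<^sub>1 q\<^sub>2 :: real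
    by (simp add: power2_eq_square add_divide_distrib algebra_simps)
  have "W i j * diff_op \<alpha> \<mu> \<beta> \<sigma> r lam w x y dx dy W i j
      = \<sigma>\<^sup>2 / 2 / dx\<^sup>2 * L i j - (r + lam) * (W i j)\<^sup>2 + 1 / dx * X i j + 1 / dy * Y i j" for i j
    unfolding diff_op_def Let_def L_def X_def Y_def a_def b_def by (rule regroup)
  then have "(\<Sum>i = 0..int m1. \<Sum>j = 0..int m2. W i j * diff_op \<alpha> \<mu> \<beta> \<sigma> r lam w x y dx dy W i j)
      = \<sigma>\<^sup>2 / 2 / dx\<^sup>2 * (\<Sum>i = 0..int m1. \<Sum>j = 0..int m2. L i j) - (r + lam) * S
        + 1 / dx * (\<Sum>i = 0..int m1. \<Sum>j = 0..int m2. X i j)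
        + 1 / dy * (\<Sum>i = 0..int m1. \<Sum>j = 0..int m2. Y i j)"
    unfolding S_def by (simp only: sum.distrib sum_subtractf sum_distrib_left)
  also have "\<dots> \<le> 0 - (r + lam) * S + K * \<alpha> * S + K * \<beta> * S"
    using L' X' Y' by (intro add_mono diff_mono) auto
  also have "\<dots> = (K * (\<alpha> + \<beta>) - (r + lam)) * S"
    by (simp add: algebra_simps)
  finally show ?thesis by (simp only: K_def S_def)
qed

text \<open>Jumps act only in \<open>y\<close>, so the Schur bound holds on each line of constant
  \<open>i\<close>.\<close>

lemma jump_op_form_le:
  fixes W :: "int \<Rightarrow> int \<Rightarrow> real"
  assumes zero: "\<And>i j. j < 0 \<or> j > int m2 \<Longrightarrow> W i j = 0"
    and grid: "uniform_grid ymin ymax m2 dy y"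
    and f: "prob_density f" "bounded (range f)" and lam: "0 \<le> lam"
  shows "(\<Sum>i = 0..int m1. \<Sum>j = 0..int m2. W i j * jump_op lam f y dy m2 W i j)
    \<le> lam * sqrt ((ymax - ymin) * sup_norm f) * (\<Sum>i = 0..int m1. \<Sum>j = 0..int m2. (W i j)\<^sup>2)"
  unfolding sum_distrib_left[where A = "{0..int m1}"]
proof (rule sum_mono)
  fix i
  have "(\<Sum>j = 0..int m2. W i j * jump_op lam f y dy m2 W i j)
      = lam * (\<Sum>j = 0..int m2. W i j * (\<Sum>l = - 1..int m2. LINT \<xi>:{y l..y (l + 1)}|lebesgue.
        ((y (l + 1) - \<xi>) / dy * W i l + (\<xi> - y l) / dy * W i (l + 1)) * f (\<xi> - y j)))"
    by (simp only: jump_op_def mult.left_commute[of _ lam] flip: sum_distrib_left)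
  also have "\<dots> \<le> lam * (sqrt ((ymax - ymin) * sup_norm f) * (\<Sum>j = 0..int m2. (W i j)\<^sup>2))"
    using lam by (intro mult_left_mono jump_form_le[OF _ grid f]) (auto simp: zero)
  finally show "(\<Sum>j = 0..int m2. W i j * jump_op lam f y dy m2 W i j)
      \<le> lam * sqrt ((ymax - ymin) * sup_norm f) * (\<Sum>j = 0..int m2. (W i j)\<^sup>2)"
    by (simp add: mult.assoc)
qed

text \<open>Rewriting both matrix products as grid operators makes the two form bounds available;
  their constants add up to \<open>C_hat\<close>.\<close>

lemma generator_form_le:
  fixes V :: "real vec"
  assumes V: "V \<in> carrier_vec (num_unknowns m1 m2)"
    and pos: "0 \<le> \<alpha>" "0 \<le> \<beta>" "0 \<le> lam"
    and f: "prob_density f" "bounded (range f)"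
    and weights: "(\<Sum>k = - 1..2. w k) = 0" "(\<Sum>k = - 1..2. of_int k * w k) = 1"
      "(\<Sum>k = - 1..2. (of_int k)\<^sup>2 * w k) = 0" "w 2 \<le> 0"
    and grids: "uniform_grid xmin xmax m1 dx x" "uniform_grid ymin ymax m2 dy y"
  shows "scalar_prod V ((matA \<alpha> \<mu> \<beta> \<sigma> r lam w x y dx dy m1 m2 + matB lam f y dy m1 m2) *\<^sub>v V)
    \<le> C_hat \<alpha> \<beta> r lam w (ymax - ymin) f * scalar_prod V V"
proof -
  define N where "N = num_unknowns m1 m2"
  define A where "A = matA \<alpha> \<mu> \<beta> \<sigma> r lam w x y dx dy m1 m2"
  define B where "B = matB lam f y dy m1 m2"
  define W where "W = dirichlet_ext m1 m2 V"
  have A: "A \<in> carrier_mat N N" and B: "B \<in> carrier_mat N N"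
    by (simp_all add: A_def B_def matA_def matB_def grid_matrix_def Let_def N_def)
  have V': "V \<in> carrier_vec N" using V by (simp add: N_def)
  have f_int: "integrable lebesgue f" using f by (simp add: prob_density_def)
  have zero: "W i j = 0" if "i < 0 \<or> i > int m1 \<or> j < 0 \<or> j > int m2" for i j
    using that by (auto simp: W_def dirichlet_ext_def)
  have AW: "dirichlet_ext m1 m2 (A *\<^sub>v V) i j = diff_op \<alpha> \<mu> \<beta> \<sigma> r lam w x y dx dy W i j"
    and BW: "dirichlet_ext m1 m2 (B *\<^sub>v V) i j = jump_op lam f y dy m2 W i j"
    if "i \<in> {0..int m1}" "j \<in> {0..int m2}" for i j
  proof -
    define i' j' where "i' = nat i" and "j' = nat j"
    with that have ij: "i = int i'" "j = int j'" "i' \<le> m1" "j' \<le> m2" by auto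
    show "dirichlet_ext m1 m2 (A *\<^sub>v V) i j = diff_op \<alpha> \<mu> \<beta> \<sigma> r lam w x y dx dy W i j"
      unfolding ij(1,2) dirichlet_ext_index[OF ij(3,4)] A_def W_def by (rule matA_mult_vec[OF V ij(3,4)])
    show "dirichlet_ext m1 m2 (B *\<^sub>v V) i j = jump_op lam f y dy m2 W i j"
      unfolding ij(1,2) dirichlet_ext_index[OF ij(3,4)] B_def W_def by (rule matB_mult_vec[OF f_int V ij(3,4)])
  qed
  have S: "scalar_prod V V = (\<Sum>i = 0..int m1. \<Sum>j = 0..int m2. (W i j)\<^sup>2)"
    using scalar_prod_grid[OF V] by (simp add: W_def power2_eq_square)
  have "scalar_prod V ((A + B) *\<^sub>v V) = scalar_prod V (A *\<^sub>v V) + scalar_prod V (B *\<^sub>v V)"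
    using A B V' by (simp add: add_mult_distrib_mat_vec[of _ N N] scalar_prod_add_distrib[of _ N])
  also have "scalar_prod V (A *\<^sub>v V)
      = (\<Sum>i = 0..int m1. \<Sum>j = 0..int m2. W i j * diff_op \<alpha> \<mu> \<beta> \<sigma> r lam w x y dx dy W i j)"
    by (subst scalar_prod_grid[of _ m1 m2]) (use A V' in \<open>auto simp: N_def AW W_def[symmetric]\<close>)
  also have "\<dots> \<le> ((\<bar>w (- 1)\<bar> - 10 * w 2) * (\<alpha> + \<beta>) - (r + lam)) * scalar_prod V V"
    unfolding S by (rule diff_form_le[OF zero weights grids pos(1,2)])
  also have "scalar_prod V (B *\<^sub>v V)
      = (\<Sum>i = 0..int m1. \<Sum>j = 0..int m2. W i j * jump_op lam f y dy m2 W i j)"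
    by (subst scalar_prod_grid[of _ m1 m2]) (use B V' in \<open>auto simp: N_def BW W_def[symmetric]\<close>)
  also have "\<dots> \<le> lam * sqrt ((ymax - ymin) * sup_norm f) * scalar_prod V V"
    unfolding S by (rule jump_op_form_le[OF zero grids(2) f pos(3)]) auto
  finally show ?thesis
    by (simp add: A_def B_def C_hat_def distrib_right)
qed

theorem theorem6:
  fixes \<alpha> \<beta> \<sigma> lam dt \<mu> r T :: real
    and f :: "real \<Rightarrow> real"
    and w :: "int \<Rightarrow> real"
    and xmin xmax ymin ymax dx dy :: real
    and x y :: "int \<Rightarrow> real"
    and m1 m2 n :: nat
  assumes pos: "\<alpha> > 0" "\<beta> > 0" "\<sigma> > 0" "lam > 0" "dt > 0" "T > 0"
    and density: "prob_density f" "bounded (range f)"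
    and weights: "(\<Sum>k = - 1..2. w k) = 0"
      "(\<Sum>k = - 1..2. of_int k * w k) = 1"
      "(\<Sum>k = - 1..2. (of_int k)\<^sup>2 * w k) = 0"
      "w 2 \<le> 0"
    and grids: "uniform_grid xmin xmax m1 dx x" "uniform_grid ymin ymax m2 dy y"
    and drift_x: "\<alpha> * (\<mu> - x 0) > 0" "\<alpha> * (\<mu> - x (int m1)) < 0"
    and drift_y: "- \<beta> * y 0 > 0" "- \<beta> * y (int m2) < 0"
    and time: "real n * dt \<le> T"
    and step: "C_hat \<alpha> \<beta> r lam w (ymax - ymin) f * dt \<le> 1"
  shows "let M = dt \<cdot>\<^sub>m (matA \<alpha> \<mu> \<beta> \<sigma> r lam w x y dx dy m1 m2 + matB lam f y dy m1 m2)
    in invertible_mat (cn_denominator M) \<and>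
       spectral_norm dx dy (cn_stability M) ^ n
         \<le> exp (2 * T * max (C_hat \<alpha> \<beta> r lam w (ymax - ymin) f) 0)"
proof -
  define N where "N = num_unknowns m1 m2"
  \<comment> \<open>The truncation at zero provides the condition \<open>0 \<le> h\<close> of the
    Cayley estimate.\<close>
  define C where "C = max (C_hat \<alpha> \<beta> r lam w (ymax - ymin) f) 0"
  define AB where "AB = matA \<alpha> \<mu> \<beta> \<sigma> r lam w x y dx dy m1 m2 + matB lam f y dy m1 m2"
  define M where "M = dt \<cdot>\<^sub>m AB"
  \<comment> \<open>Chosen so that \<open>2 * h\<close> bounds the form of \<open>M\<close>; the
    step restriction then reads \<open>h \<le> 1 / 2\<close>.\<close>
  define h where "h = dt * C / 2"
  have AB: "AB \<in> carrier_mat N N"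
    by (simp add: AB_def matA_def matB_def grid_matrix_def Let_def N_def)
  have h: "0 \<le> h" "h \<le> 1 / 2"
    using pos step by (auto simp: h_def C_def max_def mult.commute)
  have dxy: "0 < dx" "0 < dy" using grids by (auto simp: uniform_grid_def)
  have M: "M \<in> carrier_mat N N" using AB by (simp add: M_def)
  have N: "0 < N" by (simp add: N_def num_unknowns_def)
  have diss: "scalar_prod V (M *\<^sub>v V) \<le> 2 * h * scalar_prod V V" if V: "V \<in> carrier_vec N" for V
  proof -
    have "scalar_prod V (AB *\<^sub>v V) \<le> C_hat \<alpha> \<beta> r lam w (ymax - ymin) f * scalar_prod V V"
      unfolding AB_def using V pos
      by (intro generator_form_le[OF _ _ _ _ density weights grids]) (auto simp: N_def)
    also have "\<dots> \<le> C * scalar_prod V V"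
      by (intro mult_right_mono scalar_prod_self_nonneg) (simp add: C_def)
    finally have "dt * scalar_prod V (AB *\<^sub>v V) \<le> dt * (C * scalar_prod V V)"
      using pos by simp
    moreover have "M *\<^sub>v V = dt \<cdot>\<^sub>v (AB *\<^sub>v V)"
      using AB V by (auto simp: M_def scalar_prod_def sum_distrib_left mult.assoc)
    ultimately show ?thesis
      using AB V by (simp add: h_def scalar_prod_smult_distrib[of _ N] mult.assoc)
  qed
  have h1: "h < 1" using h by simp
  note cn = cn_stability_bound[OF M N dxy diss h(1) h1]
  have "spectral_norm dx dy (cn_stability M) ^ n \<le> exp (4 * h) ^ n"
    using cn cayley_le_exp[OF h] by (intro power_mono) auto
  also have "\<dots> = exp (real n * (4 * h))" by (rule exp_of_nat_mult[symmetric])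
  \<comment> \<open>The exponent equals \<open>2 * C\<close> times the elapsed time
    \<open>real n * dt\<close>, which is at most \<open>T\<close>.\<close>
  also have "\<dots> \<le> exp (2 * T * C)"
    using mult_right_mono[OF time, of C] by (simp add: h_def C_def)
  finally show ?thesis
    using cn(1) by (simp add: M_def AB_def C_def Let_def)
qed

end
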